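(* Let $m\ge 1$ be an integer, $1<p_1,\dots,p_m<\infty$, $0\le\alpha<mn$, $\frac1p=\frac1{p_1}+\cdots+\frac1{p_m}$ and $p\le q<\infty$. Let $\sigma$ and $\omega$ be weights on $\mathbb R^n$ and define $$[\sigma,\omega]_{S_{\vec P,q}}=\sup_{Q}\frac{\left(\int_Q\left(\mathcal M_\alpha(\sigma\chi_Q,\dots,\sigma\chi_Q)(x)\right)^q\omega(x)\,dx\right)^{1/q}}{\sigma(Q)^{1/p}},$$ the supremum being over all cubes $Q\subset\mathbb R^n$. Then $\mathcal M_\alpha$ is bounded from $L^{p_1}(\sigma^{-p_1/p_1'})\times\cdots\times L^{p_m}(\sigma^{-p_m/p_m'})$ to $L^q(\omega)$ if and only if $[\sigma,\omega]_{S_{\vec P,q}}$ is finite. Moreover, $$C^{-1}[\sigma,\omega]_{S_{\vec P,q}}\le\|\mathcal M_\alpha\|_{\left(\prod_{i=1}^m L^{p_i}(\sigma^{-p_i/p_i'})\right)\to L^q(\omega)}\le C\,[\sigma,\omega]_{S_{\vec P,q}},$$ where $C>0$ depends only on $n,m,\alpha,p_1,\dots,p_m,q$.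
   Context: Cubes in $\mathbb R^n$ are non-degenerate with sides parallel to the axes; $|Q|$ is Lebesgue measure. A weight is a locally integrable function on $\mathbb R^n$ that is positive almost everywhere. For a weight $\sigma$, $\sigma(Q)=\int_Q\sigma(x)\,dx$. For an a.e. positive measurable $u$, $L^p(u)$ is the space of measurable $f$ with $\int_{\mathbb R^n}|f|^pu\,dx<\infty$. $p_i'$ is the conjugate exponent of $p_i$. The multilinear fractional maximal function is, for $\vec f=(f_1,\dots,f_m)$ measurable, $$\mathcal M_\alpha\vec f(x)=\sup_Q|Q|^{\alpha/n}\prod_{i=1}^m\frac{\chi_Q(x)}{|Q|}\int_Q|f_i(y)|\,dy ,$$ the supremum over all cubes $Q$. The norm of $\mathcal M_\alpha$ is the least constant $K$ (possibly $\infty$) with $\|\mathcal M_\alpha\vec f\|_{L^q(\omega)}\le K\prod_{i=1}^m\|f_i\|_{L^{p_i}(\sigma^{-p_i/p_i'})}$ for all $\vec f$. *)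

theory Defs
  imports "HOL-Analysis.Analysis"
begin

definition cubes :: "(real ^ 'n) set set" where
  "cubes = {cbox a (a + l *\<^sub>R One) | a l. 0 < l}"

definition weight :: "(real ^ 'n \<Rightarrow> real) \<Rightarrow> bool" where
  "weight u \<longleftrightarrow>
     (\<forall>K. compact K \<longrightarrow> u absolutely_integrable_on K) \<and> (AE x in lebesgue. 0 < u x)"

definition conj_exponent :: "real \<Rightarrow> real" where
  "conj_exponent r = r / (r - 1)"

(* Only used with r > 0, where infinity to the power r is infinity. *)
definition ennpowr :: "ennreal \<Rightarrow> real \<Rightarrow> ennreal" where
  "ennpowr t r = (if t = \<infinity> then \<infinity> else ennreal (enn2real t powr r))"

(* The norm of L^r(u), for functions with values in [0, infinity]; a real function f is passed
   as |f|.  Values of u on the null set where u is not positive do not matter. *)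
definition Lp_norm :: "real \<Rightarrow> (real ^ 'n \<Rightarrow> real) \<Rightarrow> (real ^ 'n \<Rightarrow> ennreal) \<Rightarrow> ennreal" where
  "Lp_norm r u g = ennpowr (\<integral>\<^sup>+x. ennpowr (g x) r * ennreal (u x) \<partial>lebesgue) (1 / r)"

definition Lp_space :: "real \<Rightarrow> (real ^ 'n \<Rightarrow> real) \<Rightarrow> (real ^ 'n \<Rightarrow> real) set" where
  "Lp_space r u = {f \<in> borel_measurable lebesgue.
     (\<integral>\<^sup>+x. ennreal (\<bar>f x\<bar> powr r * u x) \<partial>lebesgue) < \<infinity>}"

(* A tuple of m functions is a family f of which only f 1, ..., f m matter. *)
definition frac_maximal ::
    "nat \<Rightarrow> real \<Rightarrow> (nat \<Rightarrow> real ^ 'n \<Rightarrow> real) \<Rightarrow> real ^ 'n \<Rightarrow> ennreal" where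
  "frac_maximal m \<alpha> f x =
     (SUP Q \<in> cubes. ennreal (measure lebesgue Q powr (\<alpha> / real CARD('n))) *
        (\<Prod>i = 1..m. indicator Q x / ennreal (measure lebesgue Q) *
           (\<integral>\<^sup>+y\<in>Q. ennreal \<bar>f i y\<bar> \<partial>lebesgue)))"

definition dual_weight :: "real \<Rightarrow> (real ^ 'n \<Rightarrow> real) \<Rightarrow> real ^ 'n \<Rightarrow> real" where
  "dual_weight r \<sigma> x = \<sigma> x powr (- r / conj_exponent r)"

definition dual_tuples ::
    "nat \<Rightarrow> (nat \<Rightarrow> real) \<Rightarrow> (real ^ 'n \<Rightarrow> real) \<Rightarrow> (nat \<Rightarrow> real ^ 'n \<Rightarrow> real) set" where
  "dual_tuples m P \<sigma> = {f. \<forall>i\<in>{1..m}. f i \<in> Lp_space (P i) (dual_weight (P i) \<sigma>)}"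

definition maximal_bound ::
    "nat \<Rightarrow> real \<Rightarrow> (nat \<Rightarrow> real) \<Rightarrow> real \<Rightarrow> (real ^ 'n \<Rightarrow> real) \<Rightarrow> (real ^ 'n \<Rightarrow> real) \<Rightarrow>
      ennreal \<Rightarrow> bool" where
  "maximal_bound m \<alpha> P q \<sigma> \<omega> K \<longleftrightarrow>
     (\<forall>f \<in> dual_tuples m P \<sigma>.
        Lp_norm q \<omega> (frac_maximal m \<alpha> f)
          \<le> K * (\<Prod>i = 1..m. Lp_norm (P i) (dual_weight (P i) \<sigma>) (\<lambda>x. ennreal \<bar>f i x\<bar>)))"

definition maximal_norm ::
    "nat \<Rightarrow> real \<Rightarrow> (nat \<Rightarrow> real) \<Rightarrow> real \<Rightarrow> (real ^ 'n \<Rightarrow> real) \<Rightarrow> (real ^ 'n \<Rightarrow> real) \<Rightarrow> ennreal" where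
  "maximal_norm m \<alpha> P q \<sigma> \<omega> = Inf {K. maximal_bound m \<alpha> P q \<sigma> \<omega> K}"

(* The measurability clause together with the finite bound says that the operator maps into
   L^q(\<omega>). *)
definition maximal_bounded ::
    "nat \<Rightarrow> real \<Rightarrow> (nat \<Rightarrow> real) \<Rightarrow> real \<Rightarrow> (real ^ 'n \<Rightarrow> real) \<Rightarrow> (real ^ 'n \<Rightarrow> real) \<Rightarrow> bool" where
  "maximal_bounded m \<alpha> P q \<sigma> \<omega> \<longleftrightarrow>
     (\<forall>f \<in> dual_tuples m P \<sigma>. frac_maximal m \<alpha> f \<in> borel_measurable lebesgue) \<and>
     (\<exists>K. K < \<infinity> \<and> maximal_bound m \<alpha> P q \<sigma> \<omega> K)"

definition sawyer_const ::
    "nat \<Rightarrow> real \<Rightarrow> real \<Rightarrow> real \<Rightarrow> (real ^ 'n \<Rightarrow> real) \<Rightarrow> (real ^ 'n \<Rightarrow> real) \<Rightarrow> ennreal" where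
  "sawyer_const m \<alpha> p q \<sigma> \<omega> =
     (SUP Q \<in> cubes.
        ennpowr (\<integral>\<^sup>+x\<in>Q. ennpowr (frac_maximal m \<alpha> (\<lambda>i y. \<sigma> y * indicator Q y) x) q
                          * ennreal (\<omega> x) \<partial>lebesgue) (1 / q)
        / ennreal ((LINT x:Q|lebesgue. \<sigma> x) powr (1 / p)))"

end

theory Submission
  imports Defs
begin

text \<open>
  Let \<open>d\<mu> = \<sigma> dx\<close> and \<open>f\<^sub>i = g\<^sub>i \<sigma>\<close>.  Then \<open>\<integral> f\<^sub>i\<close> over \<open>Q\<close> is \<open>\<mu>(Q)\<close> times the \<open>\<mu>\<close>-mean of \<open>g\<^sub>i\<close>, so the
  quantity attached to a cube \<open>Q\<close> factors as \<open>A\<^sub>Q a\<^sub>Q\<close>, where \<open>A\<^sub>Q\<close> is its value at \<open>(\<sigma>, \<dots>, \<sigma>)\<close> and \<open>a\<^sub>Q\<close> is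
  the product of the \<open>\<mu>\<close>-means.  For a dyadic grid, group the cubes by \<open>2\<^sup>k < a\<^sub>Q \<le> 2\<^sup>k\<^sup>+\<^sup>1\<close> and let \<open>R\<close>
  range over the maximal cubes with \<open>a\<^sub>R > 2\<^sup>k\<close>.  The testing condition on each \<open>R\<close> gives a sum of
  \<open>2\<^sup>k\<^sup>q \<mu>(R)\<^sup>q\<^sup>/\<^sup>p\<close>; as \<open>q \<ge> p\<close> this is at most the \<open>(q/p)\<close>-th power of the sum of \<open>2\<^sup>k\<^sup>p \<mu>(R)\<close>, which is
  comparable to the \<open>\<mu>\<close>-integral of \<open>(sup a\<^sub>Q)\<^sup>p\<close>.  Hoelder's inequality and the \<open>L\<^sup>r(\<mu>)\<close> bounds of the
  dyadic maximal operator, valid for every measure, finish the dyadic case.  By the one-third trick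
  \<open>2\<^sup>n\<close> shifted grids dominate all cubes.  The converse inequality is the case \<open>f\<^sub>i = \<sigma> \<chi>\<^sub>Q\<close>.
\<close>

subsection \<open>Real powers of extended nonnegative reals\<close>

lemma ennpowr_ennreal: "0 \<le> x \<Longrightarrow> ennpowr (ennreal x) r = ennreal (x powr r)"
  by (simp add: ennpowr_def)

lemma ennpowr_top [simp]: "ennpowr top r = top"
  by (simp add: ennpowr_def)

lemma ennpowr_0 [simp]: "ennpowr 0 r = 0"
  by (simp add: ennpowr_def)

lemma ennpowr_one [simp]: "ennpowr 1 r = 1"
  by (simp add: ennpowr_def)

lemma ennpowr_exponent_one [simp]: "ennpowr t 1 = t"
  by (cases t) (auto simp: ennpowr_def)

lemma ennpowr_eq_0_iff [simp]: "ennpowr t r = 0 \<longleftrightarrow> t = 0"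
  by (cases t) (auto simp: ennpowr_def ennreal_eq_0_iff)

lemma ennpowr_eq_top_iff [simp]: "ennpowr t r = top \<longleftrightarrow> t = top"
  by (cases t) (auto simp: ennpowr_def)

lemma ennpowr_mono:
  assumes "s \<le> t" "0 \<le> r"
  shows "ennpowr s r \<le> ennpowr t r"
proof (cases t)
  case (real y)
  then obtain x where "s = ennreal x" "0 \<le> x" "x \<le> y"
    using assms(1) by (cases s) (auto simp: top_unique)
  with real assms show ?thesis by (auto simp: ennpowr_ennreal intro!: ennreal_leI powr_mono2)
qed simp

lemma ennpowr_mult: "ennpowr (s * t) r = ennpowr s r * ennpowr t r"
proof (cases "s = top \<or> t = top")
  case True
  then show ?thesis
    by (cases "s = 0 \<or> t = 0") (auto simp: ennreal_top_mult ennreal_mult_top)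
next
  case False
  then obtain x y where "s = ennreal x" "0 \<le> x" "t = ennreal y" "0 \<le> y"
    by (cases s; cases t) auto
  then show ?thesis
    by (simp add: ennpowr_ennreal powr_mult flip: ennreal_mult)
qed

lemma ennpowr_prod: "ennpowr (\<Prod>i\<in>I. f i) r = (\<Prod>i\<in>I. ennpowr (f i) r)"
  by (induction I rule: infinite_finite_induct) (auto simp: ennpowr_mult)

lemma ennpowr_ennpowr: "ennpowr (ennpowr t a) b = ennpowr t (a * b)"
  by (cases t) (auto simp: ennpowr_ennreal powr_powr)

text \<open>The conventions make this law uniform in the signs of the exponents: 0 and infinity are
  fixed by every power, including negative powers and the power 0.\<close>

lemma ennpowr_add: "ennpowr t (a + b) = ennpowr t a * ennpowr t b"
  by (cases t) (auto simp: ennpowr_ennreal powr_add ennreal_mult ennreal_mult_top)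

text \<open>Nonemptiness matters because of the default values: an empty product is 1, while
  \<open>ennpowr 0 0\<close> is 0 and \<open>ennpowr top 0\<close> is infinity.\<close>

lemma ennpowr_sum_exponents:
  assumes "finite I" "I \<noteq> {}"
  shows "(\<Prod>i\<in>I. ennpowr t (\<theta> i)) = ennpowr t (\<Sum>i\<in>I. \<theta> i)"
  using assms by (induction I rule: finite_ne_induct) (auto simp: ennpowr_add)

text \<open>The powers r and 1/r are mutually inverse monotone maps. This adjunction lets powers
  commute with arbitrary suprema below.\<close>

lemma ennpowr_le_iff:
  assumes "0 < r"
  shows "ennpowr s r \<le> t \<longleftrightarrow> s \<le> ennpowr t (1 / r)"
proof
  assume "ennpowr s r \<le> t"
  then have "ennpowr (ennpowr s r) (1 / r) \<le> ennpowr t (1 / r)"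
    using assms by (intro ennpowr_mono) auto
  then show "s \<le> ennpowr t (1 / r)" using assms by (simp add: ennpowr_ennpowr)
next
  assume "s \<le> ennpowr t (1 / r)"
  then have "ennpowr s r \<le> ennpowr (ennpowr t (1 / r)) r"
    using assms by (intro ennpowr_mono) auto
  then show "ennpowr s r \<le> t" using assms by (simp add: ennpowr_ennpowr)
qed

lemma ennpowr_SUP:
  assumes "0 < r"
  shows "ennpowr (SUP i\<in>I. f i) r = (SUP i\<in>I. ennpowr (f i) r)"
proof (rule antisym)
  have "f i \<le> ennpowr (SUP i\<in>I. ennpowr (f i) r) (1 / r)" if "i \<in> I" for i
    using that assms by (subst ennpowr_le_iff[symmetric]) (auto intro: SUP_upper)
  then show "ennpowr (SUP i\<in>I. f i) r \<le> (SUP i\<in>I. ennpowr (f i) r)"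
    using assms by (auto simp: ennpowr_le_iff intro: SUP_least)
  show "(SUP i\<in>I. ennpowr (f i) r) \<le> ennpowr (SUP i\<in>I. f i) r"
    using assms by (auto intro!: SUP_least ennpowr_mono SUP_upper)
qed

lemma ennpowr_indicator [simp]: "ennpowr (indicator A x) r = indicator A x"
  by (simp split: split_indicator)

lemma borel_measurable_ennpowr [measurable (raw)]:
  assumes [measurable]: "f \<in> borel_measurable M"
  shows "(\<lambda>x. ennpowr (f x) r) \<in> borel_measurable M"
  unfolding ennpowr_def by measurable

text \<open>Write each s-th power as y times its power s - 1 and bound the second factor by that of
  the total. With s = q/p this is where p \<le> q enters.\<close>

lemma sum_ennpowr_le:
  assumes "finite I" "1 \<le> s"
  shows "(\<Sum>i\<in>I. ennpowr (f i) s) \<le> ennpowr (\<Sum>i\<in>I. f i) s"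
proof -
  have split: "ennpowr y s = y * ennpowr y (s - 1)" for y
    using ennpowr_add[of y 1 "s - 1"] by simp
  have "(\<Sum>i\<in>I. ennpowr (f i) s) \<le> (\<Sum>i\<in>I. f i * ennpowr (\<Sum>i\<in>I. f i) (s - 1))"
    unfolding split using assms
    by (intro sum_mono mult_left_mono ennpowr_mono) (auto intro: member_le_sum)
  also have "\<dots> = ennpowr (\<Sum>i\<in>I. f i) s"
    by (simp add: split sum_distrib_right)
  finally show ?thesis .
qed

text \<open>A crude form of the weighted inequality between geometric and arithmetic means:
  replacing every entry by the total avoids any convexity argument.\<close>

lemma prod_ennpowr_le_sum:
  assumes "finite I" "I \<noteq> {}" "\<And>i. i \<in> I \<Longrightarrow> 0 \<le> \<theta> i" "(\<Sum>i\<in>I. \<theta> i) = 1"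
  shows "(\<Prod>i\<in>I. ennpowr (z i) (\<theta> i)) \<le> (\<Sum>i\<in>I. z i)"
proof -
  have "(\<Prod>i\<in>I. ennpowr (z i) (\<theta> i)) \<le> (\<Prod>i\<in>I. ennpowr (\<Sum>i\<in>I. z i) (\<theta> i))"
    using assms by (intro prod_mono_ennreal ennpowr_mono) (auto intro: member_le_sum)
  also have "\<dots> = (\<Sum>i\<in>I. z i)"
    using assms by (simp add: ennpowr_sum_exponents)
  finally show ?thesis .
qed

lemma ennreal_prod_eq_top:
  fixes f :: "'i \<Rightarrow> ennreal"
  assumes "finite I" "\<And>i. i \<in> I \<Longrightarrow> f i \<noteq> 0" "j \<in> I" "f j = top"
  shows "(\<Prod>i\<in>I. f i) = top"
proof -
  have "(\<Prod>i\<in>I. f i) = f j * (\<Prod>i\<in>I - {j}. f i)"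
    using assms by (simp add: prod.remove)
  moreover have "(\<Prod>i\<in>I - {j}. f i) \<noteq> 0" using assms by auto
  ultimately show ?thesis using assms(4) by (simp add: ennreal_top_mult)
qed

text \<open>Hoelder's inequality up to the factor \<open>card I\<close>: after normalising the integrals, a weighted
  geometric mean is bounded by the sum of its entries.\<close>

lemma nn_integral_prod_ennpowr_le:
  assumes I: "finite I" "I \<noteq> {}" and \<theta>: "\<And>i. i \<in> I \<Longrightarrow> 0 < \<theta> i" "(\<Sum>i\<in>I. \<theta> i) = 1"
    and [measurable]: "\<And>i. i \<in> I \<Longrightarrow> y i \<in> borel_measurable M"
  shows "(\<integral>\<^sup>+x. (\<Prod>i\<in>I. ennpowr (y i x) (\<theta> i)) \<partial>M)
           \<le> of_nat (card I) * (\<Prod>i\<in>I. ennpowr (\<integral>\<^sup>+x. y i x \<partial>M) (\<theta> i))"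
proof -
  define Y where "Y i = (\<integral>\<^sup>+x. y i x \<partial>M)" for i
  \<comment> \<open>Only positive finite integrals can be normalised. A vanishing one makes the
    integrand zero almost everywhere, and an infinite one with none vanishing makes the right side
    infinite.\<close>
  consider (zero) i where "i \<in> I" "Y i = 0"
    | (top) i where "i \<in> I" "Y i = top" "\<And>i. i \<in> I \<Longrightarrow> Y i \<noteq> 0"
    | (fin) "\<And>i. i \<in> I \<Longrightarrow> Y i \<noteq> 0 \<and> Y i \<noteq> top"
    by blast
  then show ?thesis
  proof cases
    case zero
    then have "AE x in M. y i x = 0" by (simp add: Y_def nn_integral_0_iff_AE)
    then have "AE x in M. (\<Prod>i\<in>I. ennpowr (y i x) (\<theta> i)) = 0"
      by eventually_elim (use zero I in auto)
    then have "(\<integral>\<^sup>+x. (\<Prod>i\<in>I. ennpowr (y i x) (\<theta> i)) \<partial>M) = 0"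
      by (subst nn_integral_0_iff_AE) auto
    then show ?thesis by simp
  next
    case top
    have "(\<Prod>i\<in>I. ennpowr (Y i) (\<theta> i)) = top"
      by (rule ennreal_prod_eq_top[OF I(1) _ top(1)]) (use top in auto)
    then show ?thesis using I by (simp flip: Y_def add: ennreal_mult_top)
  next
    case fin
    have *: "(\<Prod>i\<in>I. ennpowr (y i x) (\<theta> i))
        \<le> (\<Prod>i\<in>I. ennpowr (Y i) (\<theta> i)) * (\<Sum>i\<in>I. y i x / Y i)" for x
    proof -
      have "y i x = Y i * (y i x / Y i)" if "i \<in> I" for i
        using fin[OF that]
        by (simp add: ennreal_times_divide mult.commute[of "Y i"] mult_divide_eq_ennreal)
      then have "(\<Prod>i\<in>I. ennpowr (y i x) (\<theta> i))
          = (\<Prod>i\<in>I. ennpowr (Y i) (\<theta> i)) * (\<Prod>i\<in>I. ennpowr (y i x / Y i) (\<theta> i))"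
        by (simp flip: ennpowr_mult prod.distrib)
      also have "\<dots> \<le> (\<Prod>i\<in>I. ennpowr (Y i) (\<theta> i)) * (\<Sum>i\<in>I. y i x / Y i)"
        using I \<theta> by (intro mult_left_mono prod_ennpowr_le_sum) (auto intro: less_imp_le)
      finally show ?thesis .
    qed
    have "(\<integral>\<^sup>+x. (\<Prod>i\<in>I. ennpowr (y i x) (\<theta> i)) \<partial>M)
        \<le> (\<integral>\<^sup>+x. (\<Prod>i\<in>I. ennpowr (Y i) (\<theta> i)) * (\<Sum>i\<in>I. y i x / Y i) \<partial>M)"
      by (intro nn_integral_mono *)
    also have "\<dots> = (\<Prod>i\<in>I. ennpowr (Y i) (\<theta> i)) * (\<Sum>i\<in>I. Y i / Y i)"
      by (simp add: nn_integral_cmult nn_integral_sum nn_integral_divide Y_def)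
    also have "(\<Sum>i\<in>I. Y i / Y i) = of_nat (card I)"
      using fin by (simp add: ennreal_divide_self less_top zero_less_iff_neq_zero)
    finally show ?thesis by (simp add: Y_def mult.commute)
  qed
qed

section \<open>Dyadic levels and geometric sums\<close>

text \<open>Remove the largest exponent a. The others are integers at most a - 1, so with \<rho> =
  2^(-s) the induction closes by \<rho>/(1 - \<rho>) + 1 = 1/(1 - \<rho>).\<close>

lemma sum_two_powr_below:
  fixes K :: "int set"
  assumes "finite K" "0 < s"
  shows "(\<And>k. k \<in> K \<Longrightarrow> k \<le> b) \<Longrightarrow>
    (\<Sum>k\<in>K. 2 powr (real_of_int k * s)) \<le> 2 powr (real_of_int b * s) / (1 - 2 powr (- s))"
  using assms(1)
proof (induction K arbitrary: b rule: finite_linorder_max_induct)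
  case empty
  have "2 powr (- s) < 1" using assms by (simp add: powr_minus_divide)
  then show ?case by simp
next
  case (insert a A)
  define \<rho> :: real where "\<rho> = 2 powr (- s)"
  have \<rho>: "0 < \<rho>" "\<rho> < 1" using assms by (auto simp: \<rho>_def powr_minus_divide)
  have "(\<Sum>k\<in>A. 2 powr (real_of_int k * s)) \<le> 2 powr (real_of_int (a - 1) * s) / (1 - \<rho>)"
    unfolding \<rho>_def using insert by (intro insert.IH) force
  also have "2 powr (real_of_int (a - 1) * s) = 2 powr (real_of_int a * s) * \<rho>"
    by (simp add: \<rho>_def algebra_simps powr_diff powr_minus_divide)
  finally have "(\<Sum>k\<in>insert a A. 2 powr (real_of_int k * s))
      \<le> 2 powr (real_of_int a * s) * \<rho> / (1 - \<rho>) + 2 powr (real_of_int a * s)"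
    using insert by (subst sum.insert) auto
  also have "\<dots> = 2 powr (real_of_int a * s) / (1 - \<rho>)"
    using \<rho> by (simp add: field_simps)
  also have "\<dots> \<le> 2 powr (real_of_int b * s) / (1 - \<rho>)"
    using \<rho> insert(4)[of a] assms by (intro divide_right_mono) auto
  finally show ?case by (simp add: \<rho>_def)
qed

text \<open>For s > 0 this is the sum of 2^(-ks) over k \<ge> 0.\<close>

definition geom_const :: "real \<Rightarrow> real" where
  "geom_const s = 1 / (1 - 2 powr (- s))"

lemma geom_const_pos: "0 < s \<Longrightarrow> 0 < geom_const s"
  by (auto simp: geom_const_def powr_minus_divide)

definition two_pow :: "int \<Rightarrow> ennreal" where
  "two_pow k = ennreal (2 powr real_of_int k)"

lemma two_pow_add: "two_pow (a + b) = two_pow a * two_pow b"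
  by (simp add: two_pow_def powr_add ennreal_mult)

lemma ennpowr_two_pow: "ennpowr (two_pow k) s = ennreal (2 powr (real_of_int k * s))"
  by (simp add: two_pow_def ennpowr_ennreal powr_powr)

lemma two_pow_neq_top [simp]: "two_pow k \<noteq> top"
  by (simp add: two_pow_def)

text \<open>The largest level below t dominates the geometric sum. This is the discrete layer-cake
  estimate that turns sums over superlevel sets back into integrals of powers.\<close>

lemma sum_two_pow_below:
  assumes "finite K" "0 < s"
  shows "(\<Sum>k\<in>K. ennpowr (two_pow k) s * of_bool (two_pow k < t)) \<le> ennreal (geom_const s) * ennpowr t s"
proof -
  define L where "L = {k \<in> K. two_pow k < t}"
  have eq: "(\<Sum>k\<in>K. ennpowr (two_pow k) s * of_bool (two_pow k < t)) = (\<Sum>k\<in>L. ennpowr (two_pow k) s)"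
    unfolding L_def using assms by (intro sum.mono_neutral_cong_right) auto
  show ?thesis
  proof (cases "L = {}")
    case False
    have "finite L" using assms by (simp add: L_def)
    have "(\<Sum>k\<in>L. 2 powr (real_of_int k * s)) \<le> 2 powr (real_of_int (Max L) * s) / (1 - 2 powr (- s))"
      by (rule sum_two_powr_below) (use \<open>finite L\<close> assms in auto)
    then have "ennreal (\<Sum>k\<in>L. 2 powr (real_of_int k * s))
        \<le> ennreal (geom_const s * 2 powr (real_of_int (Max L) * s))"
      by (intro ennreal_leI) (simp add: geom_const_def)
    also have "ennreal (\<Sum>k\<in>L. 2 powr (real_of_int k * s)) = (\<Sum>k\<in>L. ennpowr (two_pow k) s)"
      by (simp add: ennpowr_two_pow sum_ennreal)
    also have "ennreal (geom_const s * 2 powr (real_of_int (Max L) * s))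
        = ennreal (geom_const s) * ennpowr (two_pow (Max L)) s"
      using geom_const_pos[OF assms(2)] by (simp add: ennpowr_two_pow ennreal_mult)
    also have "\<dots> \<le> ennreal (geom_const s) * ennpowr t s"
    proof (intro mult_left_mono ennpowr_mono)
      have "Max L \<in> L" using False \<open>finite L\<close> by simp
      then show "two_pow (Max L) \<le> t" by (auto simp: L_def)
    qed (use assms in auto)
    finally show ?thesis using eq by simp
  qed (simp add: eq)
qed

lemma between_two_pow:
  assumes "t \<noteq> 0" "t \<noteq> top"
  obtains k where "two_pow k < t" "t \<le> two_pow (k + 1)"
proof -
  obtain x where x: "t = ennreal x" "0 < x" using assms by (cases t) (auto simp: ennreal_eq_0_iff)
  \<comment> \<open>The levels are open on the left and closed on the right, hence ceiling minus one
    instead of the floor.\<close>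
  define k where "k = \<lceil>log 2 x\<rceil> - 1"
  have "real_of_int k < log 2 x" "log 2 x \<le> real_of_int (k + 1)"
    unfolding k_def by linarith+
  then have "2 powr real_of_int k < x" "x \<le> 2 powr real_of_int (k + 1)"
    using x by (auto simp: less_log_iff log_le_iff)
  then show ?thesis using x by (intro that[of k]) (auto simp: two_pow_def ennreal_less_iff)
qed

lemma finite_two_pow_levels:
  assumes "finite F" "\<And>Q. Q \<in> F \<Longrightarrow> a Q \<noteq> top"
  obtains K where "finite K" "\<And>Q. Q \<in> F \<Longrightarrow> a Q \<noteq> 0 \<Longrightarrow> \<exists>k\<in>K. two_pow k < a Q \<and> a Q \<le> two_pow (k + 1)"
proof -
  have "\<exists>k. a Q \<noteq> 0 \<longrightarrow> two_pow k < a Q \<and> a Q \<le> two_pow (k + 1)" if "Q \<in> F" for Q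
    using between_two_pow[of "a Q"] assms(2)[OF that] by metis
  then obtain k where "\<And>Q. Q \<in> F \<Longrightarrow> a Q \<noteq> 0 \<Longrightarrow> two_pow (k Q) < a Q \<and> a Q \<le> two_pow (k Q + 1)"
    by metis
  then show ?thesis using assms(1) by (intro that[of "k ` F"]) auto
qed

subsection \<open>Maximal functions over laminar families\<close>

text \<open>The nesting property of dyadic cubes in isolation. The embedding theorem is proved for
  any such family and any measure, so neither doubling nor geometry enters until the grids
  appear.\<close>

definition laminar :: "'a set set \<Rightarrow> bool" where
  "laminar F \<longleftrightarrow> (\<forall>Q\<in>F. \<forall>R\<in>F. Q \<inter> R = {} \<or> Q \<subseteq> R \<or> R \<subseteq> Q)"

lemma laminar_subset: "laminar F \<Longrightarrow> G \<subseteq> F \<Longrightarrow> laminar G"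
  unfolding laminar_def by blast

definition family_max :: "'a set set \<Rightarrow> ('a set \<Rightarrow> ennreal) \<Rightarrow> 'a \<Rightarrow> ennreal" where
  "family_max F c x = (SUP Q\<in>F. c Q * indicator Q x)"

lemma family_max_upper: "Q \<in> F \<Longrightarrow> x \<in> Q \<Longrightarrow> c Q \<le> family_max F c x"
  unfolding family_max_def by (rule SUP_upper2[of Q]) auto

lemma ennpowr_family_max:
  "0 < r \<Longrightarrow> ennpowr (family_max F c x) r = family_max F (\<lambda>Q. ennpowr (c Q) r) x"
  by (simp add: family_max_def ennpowr_SUP ennpowr_mult)

text \<open>Sets with coefficient 0 are discarded, since 0 belongs to no dyadic level.\<close>

lemma family_max_leI:
  assumes "\<And>Q. Q \<in> F \<Longrightarrow> x \<in> Q \<Longrightarrow> c Q \<noteq> 0 \<Longrightarrow> c Q \<le> t"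
  shows "family_max F c x \<le> t"
  unfolding family_max_def
proof (rule SUP_least)
  fix Q assume "Q \<in> F"
  then show "c Q * indicator Q x \<le> t"
    using assms[of Q] by (cases "c Q = 0") (auto split: split_indicator)
qed

lemma borel_measurable_family_max [measurable (raw)]:
  assumes "countable F" "F \<subseteq> sets M"
  shows "family_max F c \<in> borel_measurable M"
proof -
  have "(\<lambda>x. SUP Q\<in>F. c Q * indicator Q x) \<in> borel_measurable M"
    using assms by (intro borel_measurable_SUP borel_measurable_times_ennreal borel_measurable_indicator) auto
  then show ?thesis by (simp add: family_max_def[abs_def])
qed

lemma less_family_max_iff: "t < family_max F c x \<longleftrightarrow> (\<exists>Q\<in>F. x \<in> Q \<and> t < c Q)"
  unfolding family_max_def less_SUP_iff by (auto split: split_indicator)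

text \<open>The stopping sets. Finiteness puts each selected set inside a maximal one, and two
  distinct maximal sets cannot be nested, so laminarity makes them disjoint.\<close>

lemma laminar_maximal_sets:
  assumes "finite F" "laminar F"
  obtains G where "G \<subseteq> F" "disjoint G" "\<And>Q. Q \<in> G \<Longrightarrow> P Q"
    "\<And>Q. Q \<in> F \<Longrightarrow> P Q \<Longrightarrow> \<exists>R\<in>G. Q \<subseteq> R"
proof
  define H where "H = {Q \<in> F. P Q}"
  define G where "G = {Q \<in> H. \<forall>R\<in>H. Q \<subseteq> R \<longrightarrow> Q = R}"
  have "finite H" using assms by (simp add: H_def)
  show "G \<subseteq> F" "\<And>Q. Q \<in> G \<Longrightarrow> P Q" by (auto simp: G_def H_def)
  show "disjoint G"
    unfolding disjoint_def
  proof (intro ballI impI)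
    fix Q R assume "Q \<in> G" "R \<in> G" "Q \<noteq> R"
    then have "Q \<in> F" "R \<in> F" "\<not> Q \<subseteq> R" "\<not> R \<subseteq> Q" by (auto simp: G_def H_def)
    then show "Q \<inter> R = {}" using assms(2) unfolding laminar_def by blast
  qed
  show "\<exists>R\<in>G. Q \<subseteq> R" if "Q \<in> F" "P Q" for Q
  proof -
    have "Q \<in> H" using that by (simp add: H_def)
    then obtain R where "R \<in> H" "Q \<subseteq> R" "\<forall>R'\<in>H. R \<subseteq> R' \<longrightarrow> R = R'"
      using finite_has_maximal2[OF \<open>finite H\<close>] by metis
    then show ?thesis by (auto simp: G_def)
  qed
qed

abbreviation mean :: "'a measure \<Rightarrow> ('a \<Rightarrow> ennreal) \<Rightarrow> 'a set \<Rightarrow> ennreal" where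
  "mean M g Q \<equiv> (\<integral>\<^sup>+x\<in>Q. g x \<partial>M) / emeasure M Q"

lemma less_mean_imp:
  assumes "t < mean M g Q" "emeasure M Q \<noteq> 0" "emeasure M Q \<noteq> top"
  shows "t * emeasure M Q \<le> (\<integral>\<^sup>+x\<in>Q. g x \<partial>M)"
proof -
  have "t * emeasure M Q \<le> mean M g Q * emeasure M Q"
    using assms by (intro mult_right_mono) auto
  also have "\<dots> = (\<integral>\<^sup>+x\<in>Q. g x \<partial>M)"
    using assms by (simp add: ennreal_divide_times ennreal_divide_self flip: zero_less_iff_neq_zero top.not_eq_extremum)
  finally show ?thesis .
qed

lemma sum_emeasure_level_le:
  assumes "finite F" "F \<subseteq> sets M" "G \<subseteq> F" "disjoint G" "\<And>Q. Q \<in> G \<Longrightarrow> t < a Q"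
  shows "(\<Sum>Q\<in>G. emeasure M Q) \<le> emeasure M {x \<in> space M. t < family_max F a x}"
proof -
  have "countable F" using assms by (simp add: countable_finite)
  note [measurable] = borel_measurable_family_max[OF this assms(2)]
  have "finite G" using assms(1,3) by (rule finite_subset[rotated])
  then have "(\<Sum>Q\<in>G. emeasure M Q) = emeasure M (\<Union>Q\<in>G. Q)"
    using assms by (intro sum_emeasure) (auto simp: disjoint_family_on_disjoint_image disjoint_def disjoint_family_on_def)
  also have "\<dots> \<le> emeasure M {x \<in> space M. t < family_max F a x}"
  proof (rule emeasure_mono)
    show "(\<Union>Q\<in>G. Q) \<subseteq> {x \<in> space M. t < family_max F a x}"
      using assms sets.sets_into_space unfolding less_family_max_iff by blast
  qed measurable
  finally show ?thesis .
qed

text \<open>The maximal sets with mean above t cover the superlevel set. On each of them t times the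
  measure is at most the integral of g, and disjointness adds these up with constant 1.\<close>

lemma laminar_weak_type:
  assumes F: "finite F" "laminar F" "F \<subseteq> sets M"
    and fin: "\<And>Q. Q \<in> F \<Longrightarrow> emeasure M Q \<noteq> 0 \<and> emeasure M Q \<noteq> top"
    and [measurable]: "g \<in> borel_measurable M"
  shows "t * emeasure M {x \<in> space M. t < family_max F (mean M g) x} \<le> (\<integral>\<^sup>+x. g x \<partial>M)"
proof -
  obtain G where G: "G \<subseteq> F" "disjoint G" "\<And>Q. Q \<in> G \<Longrightarrow> t < mean M g Q"
    "\<And>Q. Q \<in> F \<Longrightarrow> t < mean M g Q \<Longrightarrow> \<exists>R\<in>G. Q \<subseteq> R"
    using laminar_maximal_sets[OF F(1,2), of "\<lambda>Q. t < mean M g Q"] by blast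
  have "finite G" using G(1) F(1) by (rule finite_subset)
  have "G \<subseteq> sets M" using G(1) F(3) by (rule subset_trans)
  have "emeasure M {x \<in> space M. t < family_max F (mean M g) x} \<le> emeasure M (\<Union>G)"
    using G(4) \<open>finite G\<close> \<open>G \<subseteq> sets M\<close> unfolding less_family_max_iff
    by (intro emeasure_mono) (blast, auto)
  also have "\<dots> \<le> (\<Sum>Q\<in>G. emeasure M Q)"
    using emeasure_subadditive_finite[of G "\<lambda>Q. Q" M] \<open>finite G\<close> \<open>G \<subseteq> sets M\<close> by auto
  finally have "t * emeasure M {x \<in> space M. t < family_max F (mean M g) x}
      \<le> (\<Sum>Q\<in>G. t * emeasure M Q)"
    by (simp add: mult_left_mono flip: sum_distrib_left)
  also have "\<dots> \<le> (\<Sum>Q\<in>G. \<integral>\<^sup>+x\<in>Q. g x \<partial>M)"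
    using G fin by (intro sum_mono less_mean_imp) auto
  also have "\<dots> = (\<integral>\<^sup>+x. (\<Sum>Q\<in>G. g x * indicator Q x) \<partial>M)"
    using \<open>G \<subseteq> sets M\<close> by (intro nn_integral_sum[symmetric]) auto
  also have "\<dots> \<le> (\<integral>\<^sup>+x. g x \<partial>M)"
  proof (rule nn_integral_mono)
    fix x
    have eq: "indicator (\<Union>((\<lambda>Q. Q) ` G)) x = (\<Sum>Q\<in>G. indicator Q x :: ennreal)"
      using \<open>finite G\<close> \<open>disjoint G\<close>
      by (intro indicator_UN_disjoint) (auto simp: disjoint_def disjoint_family_on_def)
    show "(\<Sum>Q\<in>G. g x * indicator Q x) \<le> g x"
      unfolding sum_distrib_left[symmetric] eq[symmetric] by (simp split: split_indicator)
  qed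
  finally show ?thesis .
qed

text \<open>Each set containing x is controlled by the single summand of its own level, so the whole
  supremum is bounded by the sum.\<close>

lemma ennpowr_family_max_le_levels:
  assumes K: "finite K" "\<And>Q. Q \<in> F \<Longrightarrow> a Q \<noteq> 0 \<Longrightarrow> \<exists>k\<in>K. two_pow k < a Q \<and> a Q \<le> two_pow (k + 1)"
    and "0 < r"
  shows "ennpowr (family_max F a x) r
    \<le> (\<Sum>k\<in>K. ennpowr (two_pow (k + 1)) r * of_bool (two_pow k < family_max F a x))"
  unfolding ennpowr_family_max[OF assms(3)]
proof (rule family_max_leI)
  fix Q assume Q: "Q \<in> F" "x \<in> Q" "ennpowr (a Q) r \<noteq> 0"
  then obtain k where k: "k \<in> K" "two_pow k < a Q" "a Q \<le> two_pow (k + 1)"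
    using K(2)[of Q] by auto
  then have "two_pow k < family_max F a x" using Q by (auto simp: less_family_max_iff)
  have "ennpowr (a Q) r \<le> ennpowr (two_pow (k + 1)) r * of_bool (two_pow k < family_max F a x)"
    using k \<open>two_pow k < family_max F a x\<close> \<open>0 < r\<close> by (simp add: ennpowr_mono)
  also have "\<dots> \<le> (\<Sum>k\<in>K. ennpowr (two_pow (k + 1)) r * of_bool (two_pow k < family_max F a x))"
    using k K(1) by (intro member_le_sum) auto
  finally show "ennpowr (a Q) r
    \<le> (\<Sum>k\<in>K. ennpowr (two_pow (k + 1)) r * of_bool (two_pow k < family_max F a x))" .
qed

text \<open>The factor 4 is the ratio of the levels k + 1 and k - 1, and
  \<open>geom_const (r - 1)\<close> comes from summing the levels below g.\<close>

definition doob_const :: "real \<Rightarrow> real" where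
  "doob_const r = 4 powr r * geom_const (r - 1)"

lemma doob_const_pos: "1 < r \<Longrightarrow> 0 < doob_const r"
  by (simp add: doob_const_def geom_const_pos)

lemma nn_integral_of_bool:
  assumes [measurable]: "Measurable.pred M P"
  shows "(\<integral>\<^sup>+x. of_bool (P x) \<partial>M) = emeasure M {x \<in> space M. P x}"
proof -
  have "(\<integral>\<^sup>+x. of_bool (P x) \<partial>M) = (\<integral>\<^sup>+x. indicator {x \<in> space M. P x} x \<partial>M)"
    by (intro nn_integral_cong) (auto split: split_indicator)
  then show ?thesis by simp
qed

text \<open>Marcinkiewicz interpolation: a mean of \<open>g\<close> above \<open>2\<^sup>k\<close> forces the mean of \<open>g\<close> restricted to
  \<open>{g > 2\<^sup>k\<^sup>-\<^sup>1}\<close> above \<open>2\<^sup>k\<^sup>-\<^sup>1\<close>.\<close>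

lemma laminar_strong_type:
  assumes F: "finite F" "laminar F" "F \<subseteq> sets M"
    and fin: "\<And>Q. Q \<in> F \<Longrightarrow> emeasure M Q \<noteq> 0 \<and> emeasure M Q \<noteq> top \<and> (\<integral>\<^sup>+x\<in>Q. g x \<partial>M) \<noteq> top"
    and [measurable]: "g \<in> borel_measurable M" and r: "1 < r"
  shows "(\<integral>\<^sup>+x. ennpowr (family_max F (mean M g) x) r \<partial>M)
    \<le> ennreal (doob_const r) * (\<integral>\<^sup>+x. ennpowr (g x) r \<partial>M)"
proof -
  define h where "h k x = g x * of_bool (two_pow (k - 1) < g x)" for k x
  have [measurable]: "h k \<in> borel_measurable M" for k unfolding h_def by measurable
  have "countable F" using F by (simp add: countable_finite)
  note [measurable] = borel_measurable_family_max[OF this F(3)]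
  have mean_fin: "mean M g Q \<noteq> top" if "Q \<in> F" for Q
    using fin[OF that] by (simp add: ennreal_divide_eq_top_iff)
  obtain K where K: "finite K"
    "\<And>Q. Q \<in> F \<Longrightarrow> mean M g Q \<noteq> 0 \<Longrightarrow> \<exists>k\<in>K. two_pow k < mean M g Q \<and> mean M g Q \<le> two_pow (k + 1)"
    by (rule finite_two_pow_levels[OF F(1) mean_fin]) blast+
  have trunc: "two_pow (k - 1) < mean M (h k) Q" if Q: "Q \<in> F" "two_pow k < mean M g Q" for k Q
  proof -
    have [measurable]: "Q \<in> sets M" using Q F by auto
    have "(\<integral>\<^sup>+x\<in>Q. g x \<partial>M) \<le> (\<integral>\<^sup>+x. h k x * indicator Q x + two_pow (k - 1) * indicator Q x \<partial>M)"
      by (intro nn_integral_mono) (auto simp: h_def not_less split: split_indicator)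
    also have "\<dots> = (\<integral>\<^sup>+x\<in>Q. h k x \<partial>M) + two_pow (k - 1) * emeasure M Q"
      by (subst nn_integral_add) (auto simp: nn_integral_cmult_indicator)
    finally have "mean M g Q \<le> ((\<integral>\<^sup>+x\<in>Q. h k x \<partial>M) + two_pow (k - 1) * emeasure M Q) / emeasure M Q"
      by (rule divide_right_mono_ennreal)
    also have "\<dots> = mean M (h k) Q + two_pow (k - 1)"
      using fin[OF Q(1)] by (simp add: add_divide_distrib_ennreal mult_divide_eq_ennreal)
    finally have "two_pow k < mean M (h k) Q + two_pow (k - 1)" using Q(2) by (rule less_le_trans[rotated])
    moreover have "two_pow k = two_pow (k - 1) + two_pow (k - 1)"
      by (simp add: two_pow_def powr_diff flip: ennreal_plus)
    ultimately show ?thesis by (metis add_right_mono not_le)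
  qed
  have weak: "two_pow (k - 1) * emeasure M {x \<in> space M. two_pow k < family_max F (mean M g) x}
      \<le> (\<integral>\<^sup>+x. h k x \<partial>M)" for k
  proof -
    have "emeasure M {x \<in> space M. two_pow k < family_max F (mean M g) x}
      \<le> emeasure M {x \<in> space M. two_pow (k - 1) < family_max F (mean M (h k)) x}"
    proof (rule emeasure_mono)
      show "{x \<in> space M. two_pow k < family_max F (mean M g) x}
        \<subseteq> {x \<in> space M. two_pow (k - 1) < family_max F (mean M (h k)) x}"
        using trunc by (auto simp: less_family_max_iff)
    qed measurable
    then have "two_pow (k - 1) * emeasure M {x \<in> space M. two_pow k < family_max F (mean M g) x}
      \<le> two_pow (k - 1) * emeasure M {x \<in> space M. two_pow (k - 1) < family_max F (mean M (h k)) x}"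
      by (rule mult_left_mono) simp
    also have "\<dots> \<le> (\<integral>\<^sup>+x. h k x \<partial>M)"
      using F fin by (intro laminar_weak_type) auto
    finally show ?thesis .
  qed
  \<comment> \<open>One factor \<open>two_pow (k - 1)\<close> is reserved for the weak type bound.
    The remaining exponent r - 1 is positive, so the levels still sum geometrically.\<close>
  have split: "ennpowr (two_pow (k + 1)) r = ennreal (4 powr r) * ennpowr (two_pow (k - 1)) (r - 1) * two_pow (k - 1)" for k
  proof -
    have "two_pow (k + 1) = ennreal 4 * two_pow (k - 1)"
      using two_pow_add[of 2 "k - 1"] by (simp add: two_pow_def[of 2] add.commute)
    then have "ennpowr (two_pow (k + 1)) r = ennreal (4 powr r) * ennpowr (two_pow (k - 1)) ((r - 1) + 1)"
      by (simp add: ennpowr_mult ennpowr_ennreal del: ennreal_numeral)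
    then show ?thesis by (simp only: ennpowr_add mult.assoc ennpowr_exponent_one)
  qed
  have "(\<integral>\<^sup>+x. ennpowr (family_max F (mean M g) x) r \<partial>M)
      \<le> (\<integral>\<^sup>+x. (\<Sum>k\<in>K. ennpowr (two_pow (k + 1)) r * of_bool (two_pow k < family_max F (mean M g) x)) \<partial>M)"
    using r K by (intro nn_integral_mono ennpowr_family_max_le_levels) auto
  also have "\<dots> = (\<Sum>k\<in>K. ennpowr (two_pow (k + 1)) r *
      emeasure M {x \<in> space M. two_pow k < family_max F (mean M g) x})"
    by (simp add: nn_integral_sum nn_integral_cmult nn_integral_of_bool)
  also have "\<dots> \<le> (\<Sum>k\<in>K. ennreal (4 powr r) * ennpowr (two_pow (k - 1)) (r - 1) * (\<integral>\<^sup>+x. h k x \<partial>M))"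
    unfolding split mult.assoc by (intro sum_mono mult_left_mono weak) auto
  \<comment> \<open>Exchanging sum and integral leaves, at each x, a geometric sum over the levels
    with \<open>two_pow (k - 1) < g x\<close>.\<close>
  also have "\<dots> = (\<integral>\<^sup>+x. ennreal (4 powr r) * (g x *
      (\<Sum>k\<in>K. ennpowr (two_pow (k - 1)) (r - 1) * of_bool (two_pow (k - 1) < g x))) \<partial>M)"
    by (simp add: nn_integral_cmult[symmetric] nn_integral_sum[symmetric] sum_distrib_left h_def ac_simps)
  also have "\<dots> \<le> (\<integral>\<^sup>+x. ennreal (4 powr r) * (g x * (ennreal (geom_const (r - 1)) * ennpowr (g x) (r - 1))) \<partial>M)"
  proof (intro nn_integral_mono mult_left_mono)
    fix x
    have "(\<Sum>k\<in>K. ennpowr (two_pow (k - 1)) (r - 1) * of_bool (two_pow (k - 1) < g x))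
        = (\<Sum>k\<in>(\<lambda>k. k - 1) ` K. ennpowr (two_pow k) (r - 1) * of_bool (two_pow k < g x))"
      by (subst sum.reindex) (auto simp: inj_on_def)
    also have "\<dots> \<le> ennreal (geom_const (r - 1)) * ennpowr (g x) (r - 1)"
      using K r by (intro sum_two_pow_below) auto
    finally show "(\<Sum>k\<in>K. ennpowr (two_pow (k - 1)) (r - 1) * of_bool (two_pow (k - 1) < g x))
      \<le> ennreal (geom_const (r - 1)) * ennpowr (g x) (r - 1)" .
  qed auto
  also have "\<dots> = (\<integral>\<^sup>+x. ennreal (doob_const r) * ennpowr (g x) r \<partial>M)"
  proof (intro nn_integral_cong)
    fix x
    have "ennpowr (g x) r = g x * ennpowr (g x) (r - 1)" using ennpowr_add[of "g x" 1 "r - 1"] by simp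
    then show "ennreal (4 powr r) * (g x * (ennreal (geom_const (r - 1)) * ennpowr (g x) (r - 1)))
        = ennreal (doob_const r) * ennpowr (g x) r"
      using geom_const_pos[of "r - 1"] r by (simp add: doob_const_def ennreal_mult ac_simps)
  qed
  also have "\<dots> = ennreal (doob_const r) * (\<integral>\<^sup>+x. ennpowr (g x) r \<partial>M)"
    by (simp add: nn_integral_cmult)
  finally show ?thesis .
qed

section \<open>From testing on stopping sets to the multilinear embedding\<close>

text \<open>The core of the sufficiency proof, for arbitrary finite \<open>a\<close>. On a level
  \<open>a\<close> is frozen up to a factor 2, so only \<open>A\<close> remains under the supremum,
  and below a stopping set this is what the testing bound controls.\<close>

lemma laminar_sawyer_embedding:
  assumes F: "finite F" "laminar F" "F \<subseteq> sets M" and N: "sets N = sets M"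
    and a: "\<And>Q. Q \<in> F \<Longrightarrow> a Q \<noteq> top" and pq: "0 < p" "p \<le> q"
    and testing: "\<And>R. R \<in> F \<Longrightarrow>
      (\<integral>\<^sup>+x. ennpowr (family_max {Q\<in>F. Q \<subseteq> R} A x) q \<partial>N) \<le> T * ennpowr (emeasure M R) (q / p)"
  shows "(\<integral>\<^sup>+x. ennpowr (family_max F (\<lambda>Q. A Q * a Q) x) q \<partial>N)
    \<le> ennreal (2 powr q) * T * ennpowr (ennreal (geom_const p) * (\<integral>\<^sup>+x. ennpowr (family_max F a x) p \<partial>M)) (q / p)"
proof -
  have "countable F" using F by (simp add: countable_finite)
  note [measurable] = borel_measurable_family_max[OF this F(3)]
  have [measurable]: "family_max {Q\<in>F. Q \<subseteq> R} A \<in> borel_measurable N" for R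
    using F N by (intro borel_measurable_family_max) (auto simp: countable_finite)
  obtain K where K: "finite K" "\<And>Q. Q \<in> F \<Longrightarrow> a Q \<noteq> 0 \<Longrightarrow> \<exists>k\<in>K. two_pow k < a Q \<and> a Q \<le> two_pow (k + 1)"
    by (rule finite_two_pow_levels[OF F(1) a]) blast+
  \<comment> \<open>One stopping family per level. A set can be maximal for several levels, so the
    sums run over the pairs in \<open>Sigma K G\<close>.\<close>
  have "\<exists>G. G \<subseteq> F \<and> disjoint G \<and> (\<forall>Q\<in>G. two_pow k < a Q) \<and> (\<forall>Q\<in>F. two_pow k < a Q \<longrightarrow> (\<exists>R\<in>G. Q \<subseteq> R))" for k
    using laminar_maximal_sets[OF F(1,2), of "\<lambda>Q. two_pow k < a Q"] by metis
  then obtain G where G: "\<And>k. G k \<subseteq> F" "\<And>k. disjoint (G k)" "\<And>k Q. Q \<in> G k \<Longrightarrow> two_pow k < a Q"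
    "\<And>k Q. Q \<in> F \<Longrightarrow> two_pow k < a Q \<Longrightarrow> \<exists>R\<in>G k. Q \<subseteq> R"
    by metis
  have finG: "finite (G k)" for k using G(1) F(1) finite_subset by blast
  have q: "0 < q" using pq by simp
  have pointwise: "ennpowr (family_max F (\<lambda>Q. A Q * a Q) x) q
    \<le> (\<Sum>(k, R)\<in>Sigma K G. ennpowr (two_pow (k + 1)) q * ennpowr (family_max {Q\<in>F. Q \<subseteq> R} A x) q)" for x
    unfolding ennpowr_family_max[OF q, of F]
  proof (rule family_max_leI)
    fix Q assume Q: "Q \<in> F" "x \<in> Q" "ennpowr (A Q * a Q) q \<noteq> 0"
    then obtain k where k: "k \<in> K" "two_pow k < a Q" "a Q \<le> two_pow (k + 1)"
      using K(2)[of Q] by auto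
    obtain R where R: "R \<in> G k" "Q \<subseteq> R" using G(4)[OF Q(1) k(2)] by auto
    have "ennpowr (A Q * a Q) q \<le> ennpowr (two_pow (k + 1)) q * ennpowr (family_max {Q\<in>F. Q \<subseteq> R} A x) q"
      unfolding ennpowr_mult[of "A Q"] mult.commute[of "ennpowr (A Q) q"]
      using k R Q q by (intro mult_mono ennpowr_mono family_max_upper) auto
    also have "\<dots> = (case (k, R) of (k, R) \<Rightarrow> ennpowr (two_pow (k + 1)) q * ennpowr (family_max {Q\<in>F. Q \<subseteq> R} A x) q)"
      by simp
    also have "\<dots> \<le> (\<Sum>(k, R)\<in>Sigma K G. ennpowr (two_pow (k + 1)) q * ennpowr (family_max {Q\<in>F. Q \<subseteq> R} A x) q)"
      using k R K(1) finG by (intro member_le_sum) auto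
    finally show "ennpowr (A Q * a Q) q \<le> \<dots>" .
  qed
  \<comment> \<open>The q-th power of the level moves inside the exponent q/p as a p-th power;
    \<open>2 powr q\<close> is the price of passing from level k + 1 to level k.\<close>
  have powers: "ennpowr (two_pow (k + 1)) q * (T * ennpowr t (q / p))
      = ennreal (2 powr q) * T * ennpowr (ennpowr (two_pow k) p * t) (q / p)" for k t
  proof -
    have "two_pow (k + 1) = ennreal 2 * two_pow k"
      using two_pow_add[of 1 k] by (simp add: two_pow_def[of 1] add.commute)
    then have "ennpowr (two_pow (k + 1)) q = ennreal (2 powr q) * ennpowr (ennpowr (two_pow k) p) (q / p)"
      using pq by (simp add: ennpowr_mult ennpowr_ennreal ennpowr_ennpowr del: ennreal_numeral)
    then show ?thesis by (simp add: ennpowr_mult ac_simps)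
  qed
  have "(\<integral>\<^sup>+x. ennpowr (family_max F (\<lambda>Q. A Q * a Q) x) q \<partial>N)
    \<le> (\<integral>\<^sup>+x. (\<Sum>(k, R)\<in>Sigma K G. ennpowr (two_pow (k + 1)) q * ennpowr (family_max {Q\<in>F. Q \<subseteq> R} A x) q) \<partial>N)"
    by (intro nn_integral_mono pointwise)
  also have "\<dots> = (\<Sum>(k, R)\<in>Sigma K G. ennpowr (two_pow (k + 1)) q * (\<integral>\<^sup>+x. ennpowr (family_max {Q\<in>F. Q \<subseteq> R} A x) q \<partial>N))"
    by (subst nn_integral_sum) (auto simp: nn_integral_cmult split_beta)
  also have "\<dots> \<le> (\<Sum>(k, R)\<in>Sigma K G. ennpowr (two_pow (k + 1)) q * (T * ennpowr (emeasure M R) (q / p)))"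
    using G(1) by (intro sum_mono) (auto intro!: mult_left_mono testing)
  also have "\<dots> = ennreal (2 powr q) * T * (\<Sum>(k, R)\<in>Sigma K G. ennpowr (ennpowr (two_pow k) p * emeasure M R) (q / p))"
    unfolding powers by (simp add: sum_distrib_left split_beta)
  \<comment> \<open>As q/p is at least 1, superadditivity brings the sum inside the power.\<close>
  also have "\<dots> \<le> ennreal (2 powr q) * T * ennpowr (\<Sum>(k, R)\<in>Sigma K G. ennpowr (two_pow k) p * emeasure M R) (q / p)"
    using pq K(1) finG sum_ennpowr_le[of "Sigma K G" "q / p" "\<lambda>(k, R). ennpowr (two_pow k) p * emeasure M R"]
    by (intro mult_left_mono) (auto simp: split_beta)
  also have "(\<Sum>(k, R)\<in>Sigma K G. ennpowr (two_pow k) p * emeasure M R)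
      = (\<Sum>k\<in>K. ennpowr (two_pow k) p * (\<Sum>R\<in>G k. emeasure M R))"
    using K(1) finG by (subst sum.Sigma[symmetric]) (auto simp: sum_distrib_left)
  also have "ennreal (2 powr q) * T * ennpowr \<dots> (q / p)
     \<le> ennreal (2 powr q) * T * ennpowr (ennreal (geom_const p) * (\<integral>\<^sup>+x. ennpowr (family_max F a x) p \<partial>M)) (q / p)"
  proof (intro mult_left_mono ennpowr_mono)
    \<comment> \<open>At each level the stopping sets are disjoint parts of a superlevel set of the
      maximal function, so the layer-cake estimate recovers its p-th power.\<close>
    have "(\<Sum>k\<in>K. ennpowr (two_pow k) p * (\<Sum>R\<in>G k. emeasure M R))
      \<le> (\<Sum>k\<in>K. ennpowr (two_pow k) p * emeasure M {x \<in> space M. two_pow k < family_max F a x})"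
      using F G by (intro sum_mono mult_left_mono sum_emeasure_level_le) auto
    also have "\<dots> = (\<integral>\<^sup>+x. (\<Sum>k\<in>K. ennpowr (two_pow k) p * of_bool (two_pow k < family_max F a x)) \<partial>M)"
      by (simp add: nn_integral_sum nn_integral_cmult nn_integral_of_bool)
    also have "\<dots> \<le> (\<integral>\<^sup>+x. ennreal (geom_const p) * ennpowr (family_max F a x) p \<partial>M)"
      using K pq by (intro nn_integral_mono sum_two_pow_below) auto
    also have "\<dots> = ennreal (geom_const p) * (\<integral>\<^sup>+x. ennpowr (family_max F a x) p \<partial>M)"
      by (simp add: nn_integral_cmult)
    finally show "(\<Sum>k\<in>K. ennpowr (two_pow k) p * (\<Sum>R\<in>G k. emeasure M R)) \<le> \<dots>" .
  qed (use pq in auto)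
  finally show ?thesis .
qed

lemma ennreal_prod_neq_top:
  fixes f :: "'i \<Rightarrow> ennreal"
  assumes "\<And>i. i \<in> I \<Longrightarrow> f i \<noteq> top"
  shows "(\<Prod>i\<in>I. f i) \<noteq> top"
  using assms by (induction I rule: infinite_finite_induct) (auto simp: ennreal_mult_eq_top_iff)

lemma le_one_plus_ennpowr:
  assumes "1 \<le> r"
  shows "t \<le> 1 + ennpowr t r"
proof (cases "t \<le> 1")
  case False
  then have "t * ennpowr 1 (r - 1) \<le> t * ennpowr t (r - 1)"
    using assms by (intro mult_left_mono ennpowr_mono) auto
  also have "\<dots> = ennpowr t r" using ennpowr_add[of t 1 "r - 1"] by simp
  finally show ?thesis by (simp add: add_increasing)
qed (simp add: add_increasing2)

text \<open>Local integrability follows from t \<le> 1 + t^r. It keeps the means finite, so that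
  each nonzero mean has a dyadic level.\<close>

lemma set_nn_integral_neq_top:
  assumes "1 \<le> r" "emeasure M Q \<noteq> top" "(\<integral>\<^sup>+x. ennpowr (g x) r \<partial>M) \<noteq> top"
    and [measurable]: "g \<in> borel_measurable M" "Q \<in> sets M"
  shows "(\<integral>\<^sup>+x\<in>Q. g x \<partial>M) \<noteq> top"
proof -
  have "(\<integral>\<^sup>+x\<in>Q. g x \<partial>M) \<le> (\<integral>\<^sup>+x. indicator Q x + ennpowr (g x) r \<partial>M)"
    using le_one_plus_ennpowr[OF assms(1)] by (intro nn_integral_mono) (auto split: split_indicator)
  also have "\<dots> = emeasure M Q + (\<integral>\<^sup>+x. ennpowr (g x) r \<partial>M)"
    by (simp add: nn_integral_add)
  also have "\<dots> < top" using assms by (simp add: top.not_eq_extremum)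
  finally show ?thesis by simp
qed

text \<open>The sources of the factors: \<open>2 powr q\<close> and \<open>geom_const p\<close> from
  the stopping argument, \<open>card I\<close> from the crude Hoelder inequality, and
  \<open>doob_const (P i)\<close> from the maximal theorem in each variable.\<close>

definition embedding_const :: "'i set \<Rightarrow> ('i \<Rightarrow> real) \<Rightarrow> real \<Rightarrow> real \<Rightarrow> real" where
  "embedding_const I P p q = 2 powr q *
     (geom_const p * (real (card I) * (\<Prod>i\<in>I. doob_const (P i) powr (p / P i)))) powr (q / p)"

lemma multilinear_laminar_embedding_finite:
  assumes F: "finite F" "laminar F" "F \<subseteq> sets M" and N: "sets N = sets M"
    and M: "\<And>Q. Q \<in> F \<Longrightarrow> emeasure M Q \<noteq> 0 \<and> emeasure M Q \<noteq> top"
    and I: "finite I" "I \<noteq> {}" and P: "\<And>i. i \<in> I \<Longrightarrow> 1 < P i" "1 / p = (\<Sum>i\<in>I. 1 / P i)" "p \<le> q"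
    and g: "\<And>i. i \<in> I \<Longrightarrow> g i \<in> borel_measurable M"
    and fin: "\<And>i. i \<in> I \<Longrightarrow> (\<integral>\<^sup>+x. ennpowr (g i x) (P i) \<partial>M) \<noteq> top"
    and testing: "\<And>R. R \<in> F \<Longrightarrow>
      (\<integral>\<^sup>+x. ennpowr (family_max {Q\<in>F. Q \<subseteq> R} A x) q \<partial>N) \<le> T * ennpowr (emeasure M R) (q / p)"
  shows "(\<integral>\<^sup>+x. ennpowr (family_max F (\<lambda>Q. A Q * (\<Prod>i\<in>I. mean M (g i) Q)) x) q \<partial>N)
    \<le> ennreal (embedding_const I P p q) * T *
       (\<Prod>i\<in>I. ennpowr (\<integral>\<^sup>+x. ennpowr (g i x) (P i) \<partial>M) (q / P i))"
proof -
  have "countable F" using F by (simp add: countable_finite)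
  note [measurable] = borel_measurable_family_max[OF this F(3)]
  have P0: "0 < P i" if "i \<in> I" for i using P(1)[OF that] by simp
  have "0 < 1 / p" unfolding P(2) using I P0 by (intro sum_pos) auto
  then have p: "0 < p" by simp
  let ?G = "\<lambda>i. \<integral>\<^sup>+x. ennpowr (g i x) (P i) \<partial>M"
  let ?mx = "\<lambda>i. family_max F (mean M (g i))"
  define a where "a Q = (\<Prod>i\<in>I. mean M (g i) Q)" for Q
  have fin': "(\<integral>\<^sup>+x\<in>Q. g i x \<partial>M) \<noteq> top" if "Q \<in> F" "i \<in> I" for Q i
    using that P(1)[of i] M g fin F by (intro set_nn_integral_neq_top[where r = "P i"]) auto
  have a: "a Q \<noteq> top" if "Q \<in> F" for Q
    unfolding a_def using that M fin' by (intro ennreal_prod_neq_top) (auto simp: ennreal_divide_eq_top_iff)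
  have "(\<integral>\<^sup>+x. ennpowr (family_max F a x) p \<partial>M)
      \<le> (\<integral>\<^sup>+x. (\<Prod>i\<in>I. ennpowr (ennpowr (?mx i x) (P i)) (p / P i)) \<partial>M)"
  proof (rule nn_integral_mono)
    fix x
    \<comment> \<open>A supremum of products is at most the product of the suprema; this separates
      the functions before Hoelder with exponents p / P i.\<close>
    have "family_max F a x \<le> (\<Prod>i\<in>I. ?mx i x)"
      by (rule family_max_leI) (auto simp: a_def intro!: prod_mono_ennreal family_max_upper)
    then have "ennpowr (family_max F a x) p \<le> ennpowr (\<Prod>i\<in>I. ?mx i x) p"
      using p by (intro ennpowr_mono) auto
    also have "\<dots> = (\<Prod>i\<in>I. ennpowr (ennpowr (?mx i x) (P i)) (p / P i))"
      unfolding ennpowr_prod by (intro prod.cong) (auto simp: ennpowr_ennpowr dest: P0)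
    finally show "ennpowr (family_max F a x) p \<le> \<dots>" .
  qed
  also have "\<dots> \<le> of_nat (card I) * (\<Prod>i\<in>I. ennpowr (\<integral>\<^sup>+x. ennpowr (?mx i x) (P i) \<partial>M) (p / P i))"
  proof (rule nn_integral_prod_ennpowr_le)
    have "(\<Sum>i\<in>I. p / P i) = p * (1 / p)" unfolding P(2) by (simp add: sum_distrib_left)
    then show "(\<Sum>i\<in>I. p / P i) = 1" using p by simp
  qed (use I p P0 in auto)
  also have "\<dots> \<le> of_nat (card I) * (\<Prod>i\<in>I. ennpowr (ennreal (doob_const (P i)) * ?G i) (p / P i))"
    using F M fin' g P P0 p
    by (intro mult_left_mono prod_mono_ennreal ennpowr_mono laminar_strong_type) (auto intro: less_imp_le)
  also have "\<dots> = ennreal (real (card I) * (\<Prod>i\<in>I. doob_const (P i) powr (p / P i))) *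
      (\<Prod>i\<in>I. ennpowr (?G i) (p / P i))"
    using P doob_const_pos
    by (simp add: ennpowr_mult prod.distrib ennreal_mult prod_nonneg less_imp_le ennpowr_ennreal mult.assoc
        flip: ennreal_of_nat_eq_real_of_nat prod_ennreal)
  finally have *: "(\<integral>\<^sup>+x. ennpowr (family_max F a x) p \<partial>M) \<le> \<dots>" .
  have "(\<integral>\<^sup>+x. ennpowr (family_max F (\<lambda>Q. A Q * a Q) x) q \<partial>N)
    \<le> ennreal (2 powr q) * T * ennpowr (ennreal (geom_const p) * (\<integral>\<^sup>+x. ennpowr (family_max F a x) p \<partial>M)) (q / p)"
    by (rule laminar_sawyer_embedding[OF F N a p \<open>p \<le> q\<close> testing])
  also have "\<dots> \<le> ennreal (2 powr q) * T * ennpowr (ennreal (geom_const p) *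
      (ennreal (real (card I) * (\<Prod>i\<in>I. doob_const (P i) powr (p / P i))) * (\<Prod>i\<in>I. ennpowr (?G i) (p / P i)))) (q / p)"
    using p \<open>p \<le> q\<close> by (intro mult_left_mono ennpowr_mono *) auto
  also have "\<dots> = ennreal (embedding_const I P p q) * T * (\<Prod>i\<in>I. ennpowr (?G i) (q / P i))"
  proof -
    have "ennpowr (ennpowr (?G i) (p / P i)) (q / p) = ennpowr (?G i) (q / P i)" for i
      using p by (simp add: ennpowr_ennpowr)
    moreover have "0 \<le> (\<Prod>i\<in>I. doob_const (P i) powr (p / P i))"
      by (intro prod_nonneg) auto
    ultimately show ?thesis
      using geom_const_pos[OF p]
      by (simp add: embedding_const_def ennpowr_mult ennpowr_prod ennpowr_ennreal ennreal_mult' powr_mult ac_simps)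
  qed
  finally show ?thesis by (simp add: a_def)
qed

text \<open>Monotone convergence along the initial segments of an enumeration of D. It removes the
  finiteness that the choice of maximal sets required.\<close>

lemma nn_integral_family_max_le:
  assumes D: "countable D" "D \<subseteq> sets N" and "0 < q"
    and le: "\<And>F. finite F \<Longrightarrow> F \<subseteq> D \<Longrightarrow> (\<integral>\<^sup>+x. ennpowr (family_max F c x) q \<partial>N) \<le> B"
  shows "(\<integral>\<^sup>+x. ennpowr (family_max D c x) q \<partial>N) \<le> B"
proof (cases "D = {}")
  case True
  then show ?thesis using le[of "{}"] by simp
next
  case False
  define F where "F n = from_nat_into D ` {..n}" for n :: nat
  have F: "finite (F n)" "F n \<subseteq> D" for n
    using from_nat_into[OF False] by (auto simp: F_def)
  have meas: "family_max (F n) c \<in> borel_measurable N" for n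
    using F D by (intro borel_measurable_family_max) (auto simp: countable_finite)
  have UF: "(\<Union>n. F n) = D"
    using F(2) from_nat_into_surj[OF D(1)] by (fastforce simp: F_def)
  have "family_max D c x = (SUP n. family_max (F n) c x)" for x
    unfolding family_max_def UF[symmetric] SUP_UNION ..
  then have "(\<integral>\<^sup>+x. ennpowr (family_max D c x) q \<partial>N) = (\<integral>\<^sup>+x. (SUP n. ennpowr (family_max (F n) c x) q) \<partial>N)"
    using \<open>0 < q\<close> by (simp add: ennpowr_SUP)
  also have "\<dots> = (SUP n. \<integral>\<^sup>+x. ennpowr (family_max (F n) c x) q \<partial>N)"
  proof (rule nn_integral_monotone_convergence_SUP)
    show "incseq (\<lambda>n x. ennpowr (family_max (F n) c x) q)"
      unfolding incseq_def le_fun_def family_max_def using \<open>0 < q\<close>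
      by (auto simp: F_def intro!: ennpowr_mono SUP_subset_mono image_mono)
  qed (use meas in measurable)
  also have "\<dots> \<le> B" using le[OF F] by (rule SUP_least)
  finally show ?thesis .
qed

lemma multilinear_laminar_embedding:
  assumes D: "countable D" "laminar D" "D \<subseteq> sets M" and N: "sets N = sets M"
    and M: "\<And>Q. Q \<in> D \<Longrightarrow> emeasure M Q \<noteq> 0 \<and> emeasure M Q \<noteq> top"
    and I: "finite I" "I \<noteq> {}" and P: "\<And>i. i \<in> I \<Longrightarrow> 1 < P i" "1 / p = (\<Sum>i\<in>I. 1 / P i)" "p \<le> q"
    and g: "\<And>i. i \<in> I \<Longrightarrow> g i \<in> borel_measurable M"
    and fin: "\<And>i. i \<in> I \<Longrightarrow> (\<integral>\<^sup>+x. ennpowr (g i x) (P i) \<partial>M) \<noteq> top"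
    and testing: "\<And>R. R \<in> D \<Longrightarrow>
      (\<integral>\<^sup>+x. ennpowr (family_max {Q\<in>D. Q \<subseteq> R} A x) q \<partial>N) \<le> T * ennpowr (emeasure M R) (q / p)"
  shows "(\<integral>\<^sup>+x. ennpowr (family_max D (\<lambda>Q. A Q * (\<Prod>i\<in>I. mean M (g i) Q)) x) q \<partial>N)
    \<le> ennreal (embedding_const I P p q) * T *
       (\<Prod>i\<in>I. ennpowr (\<integral>\<^sup>+x. ennpowr (g i x) (P i) \<partial>M) (q / P i))"
proof (rule nn_integral_family_max_le)
  have "0 < 1 / p" unfolding P(2) using I P(1) by (intro sum_pos) (auto intro: order.strict_trans[of 0 1])
  then show q: "0 < q" using P(3) by simp
  fix F assume F: "finite F" "F \<subseteq> D"
  show "(\<integral>\<^sup>+x. ennpowr (family_max F (\<lambda>Q. A Q * (\<Prod>i\<in>I. mean M (g i) Q)) x) q \<partial>N)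
    \<le> ennreal (embedding_const I P p q) * T *
       (\<Prod>i\<in>I. ennpowr (\<integral>\<^sup>+x. ennpowr (g i x) (P i) \<partial>M) (q / P i))"
  proof (rule multilinear_laminar_embedding_finite[OF F(1) laminar_subset[OF D(2) F(2)] _ N _ I P g fin])
    fix R assume "R \<in> F"
    \<comment> \<open>Fewer sets give a smaller localised maximal function, so finite subfamilies
      inherit the testing bound.\<close>
    have "(\<integral>\<^sup>+x. ennpowr (family_max {Q\<in>F. Q \<subseteq> R} A x) q \<partial>N) \<le> (\<integral>\<^sup>+x. ennpowr (family_max {Q\<in>D. Q \<subseteq> R} A x) q \<partial>N)"
      unfolding family_max_def using F q by (intro nn_integral_mono ennpowr_mono SUP_subset_mono) auto
    also have "\<dots> \<le> T * ennpowr (emeasure M R) (q / p)" using testing \<open>R \<in> F\<close> F by auto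
    finally show "(\<integral>\<^sup>+x. ennpowr (family_max {Q\<in>F. Q \<subseteq> R} A x) q \<partial>N) \<le> T * ennpowr (emeasure M R) (q / p)" .
  qed (use F D M in auto)
qed (use D N in auto)

subsection \<open>Shifted dyadic grids\<close>

text \<open>Fibres of a floor map are half-open cubes. At each scale they partition space exactly,
  so the grids are laminar without exceptional null sets.\<close>

definition grid_cube :: "real \<Rightarrow> real ^ 'n \<Rightarrow> int ^ 'n \<Rightarrow> (real ^ 'n) set" where
  "grid_cube h \<tau> j = {x. \<forall>i. \<lfloor>(x $ i - \<tau> $ i) / h\<rfloor> = j $ i}"

text \<open>The sides are \<open>2\<^sup>N\<^sup>-\<^sup>l\<close> and the coordinates in \<open>S\<close> are shifted by \<open>2\<^sup>N/3\<close>.  One shift serves all scales: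
  modulo the side it is one or two thirds of the side, as 3 does not divide \<open>2\<^sup>l\<close>.
  The restriction to sides at most \<open>2\<^sup>N\<close> is removed by letting \<open>N\<close> tend to infinity.\<close>

definition grid :: "nat \<Rightarrow> 'n set \<Rightarrow> (real ^ 'n) set set" where
  "grid N S = (\<Union>l. range (grid_cube (2 ^ N / 2 ^ l) (\<chi> i. if i \<in> S then 2 ^ N / 3 else 0)))"

lemma countable_grid: "countable (grid N (S :: 'n::finite set))"
  unfolding grid_def by (intro countable_UN countable_image) auto

lemma grid_cube_nested:
  fixes \<tau> :: "real ^ 'n"
  assumes "l \<le> l'" "x \<in> grid_cube (2 ^ N / 2 ^ l') \<tau> j'" "x \<in> grid_cube (2 ^ N / 2 ^ l) \<tau> j"
  shows "grid_cube (2 ^ N / 2 ^ l') \<tau> j' \<subseteq> grid_cube (2 ^ N / 2 ^ l) \<tau> j"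
proof -
  \<comment> \<open>The index at the coarse scale is an integer quotient of the index at the fine
    scale, so points sharing a fine cube share the coarse one.\<close>
  have coarse: "\<lfloor>t / (2 ^ N / 2 ^ l)\<rfloor> = \<lfloor>t / (2 ^ N / 2 ^ l')\<rfloor> div 2 ^ (l' - l)" for t :: real
  proof -
    have "(2::real) ^ l' = 2 ^ l * 2 ^ (l' - l)" using assms(1) by (simp flip: power_add)
    then have "t / (2 ^ N / 2 ^ l) = t / (2 ^ N / 2 ^ l') / real_of_int (2 ^ (l' - l))"
      by simp
    then show ?thesis by (simp only: floor_divide_real_eq_div[of "2 ^ (l' - l)"] zero_le_power zero_le_numeral)
  qed
  show ?thesis
    using assms(2,3) unfolding grid_cube_def coarse by auto
qed

lemma laminar_grid: "laminar (grid N (S :: 'n::finite set))"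
  unfolding laminar_def
proof (intro ballI)
  fix Q R assume QR: "Q \<in> grid N S" "R \<in> grid N S"
  obtain l j l' j' where Q: "Q = grid_cube (2 ^ N / 2 ^ l) (\<chi> i. if i \<in> S then 2 ^ N / 3 else 0) j"
    and R: "R = grid_cube (2 ^ N / 2 ^ l') (\<chi> i. if i \<in> S then 2 ^ N / 3 else 0) j'"
    using QR by (auto simp: grid_def)
  show "Q \<inter> R = {} \<or> Q \<subseteq> R \<or> R \<subseteq> Q"
  proof (cases "Q \<inter> R = {}")
    case False
    then obtain x where "x \<in> Q" "x \<in> R" by auto
    then show ?thesis
      using grid_cube_nested[of l l' x] grid_cube_nested[of l' l x] unfolding Q R
      by (metis linear)
  qed simp
qed

lemma sum_Basis_nth [simp]: "(\<Sum>x\<in>(Basis :: (real ^ 'n) set). x $ i) = 1"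
proof -
  have "One \<bullet> axis i (1::real) = (1::real)" for i :: 'n
    by (simp add: axis_in_Basis_iff)
  then show ?thesis by (simp add: inner_axis)
qed

lemma grid_cube_between:
  fixes \<tau> :: "real ^ 'n" and j :: "int ^ 'n"
  assumes "0 < h"
  defines "a \<equiv> \<tau> + h *\<^sub>R (\<chi> i. real_of_int (j $ i))"
  shows "box a (a + h *\<^sub>R One) \<subseteq> grid_cube h \<tau> j" "grid_cube h \<tau> j \<subseteq> cbox a (a + h *\<^sub>R One)"
proof -
  have *: "\<lfloor>(x $ i - \<tau> $ i) / h\<rfloor> = j $ i \<longleftrightarrow> a $ i \<le> x $ i \<and> x $ i < a $ i + h" for x i
    using assms(1) by (simp add: floor_eq_iff a_def field_simps)
  show "box a (a + h *\<^sub>R One) \<subseteq> grid_cube h \<tau> j" "grid_cube h \<tau> j \<subseteq> cbox a (a + h *\<^sub>R One)"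
    unfolding grid_cube_def * mem_box_cart
    by (auto simp: mem_box_cart less_imp_le)
qed

lemma closure_grid_cube:
  fixes \<tau> :: "real ^ 'n" and j :: "int ^ 'n"
  assumes "0 < h"
  defines "a \<equiv> \<tau> + h *\<^sub>R (\<chi> i. real_of_int (j $ i))"
  shows "closure (grid_cube h \<tau> j) = cbox a (a + h *\<^sub>R One)"
proof
  have "box a (a + h *\<^sub>R One) \<noteq> {}" using assms by (auto simp: box_ne_empty inner_simps)
  then have "closure (box a (a + h *\<^sub>R One)) = cbox a (a + h *\<^sub>R One)" by (rule closure_box)
  then show "cbox a (a + h *\<^sub>R One) \<subseteq> closure (grid_cube h \<tau> j)"
    using closure_mono[OF grid_cube_between(1)[OF assms(1)]] unfolding a_def by metis
  show "closure (grid_cube h \<tau> j) \<subseteq> cbox a (a + h *\<^sub>R One)"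
    using grid_cube_between(2)[OF assms(1)] unfolding a_def by (intro closure_minimal) auto
qed

text \<open>The maximal function and the testing constant use closed cubes, the grids half-open
  ones. Passing to the closure adds only part of the boundary, a null set.\<close>

lemma closure_grid:
  assumes "Q \<in> grid N (S :: 'n::finite set)"
  shows "closure Q \<in> cubes" "negligible (closure Q - Q)" "Q \<in> sets lebesgue"
proof -
  obtain l j where Q: "Q = grid_cube (2 ^ N / 2 ^ l) (\<chi> i. if i \<in> S then 2 ^ N / 3 else 0) j"
    using assms by (auto simp: grid_def)
  define h :: real where "h = 2 ^ N / 2 ^ l"
  define \<tau> :: "real ^ 'n" where "\<tau> = (\<chi> i. if i \<in> S then 2 ^ N / 3 else 0)"
  define a where "a = \<tau> + h *\<^sub>R (\<chi> i. real_of_int (j $ i))"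
  have h: "0 < h" by (simp add: h_def)
  have cl: "closure Q = cbox a (a + h *\<^sub>R One)"
    unfolding Q a_def using closure_grid_cube[OF h, of \<tau> j] by (simp add: h_def \<tau>_def)
  have sub: "box a (a + h *\<^sub>R One) \<subseteq> Q"
    unfolding Q a_def using grid_cube_between(1)[OF h, of \<tau> j] by (simp add: h_def \<tau>_def)
  show "closure Q \<in> cubes" using h by (auto simp: cl cubes_def)
  show neg: "negligible (closure Q - Q)"
    by (rule negligible_subset[OF negligible_frontier_interval[of a "a + h *\<^sub>R One"]]) (use sub cl in auto)
  have "Q = closure Q - (closure Q - Q)" using closure_subset by auto
  also have "\<dots> \<in> sets lebesgue"
    by (rule sets.Diff) (use neg negligible_imp_sets in auto)
  finally show "Q \<in> sets lebesgue" .
qed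

text \<open>If both grids cut the interval, then points h j and h j' + 2^N/3 lie in it at distance
  less than s \<le> h/3. Multiplying by 3/h and using 2^N = h 2^l gives |3(j - j') - 2^l| < 1, so 3
  would divide 2^l.\<close>

lemma one_third_trick:
  fixes a h s :: real
  assumes "0 < s" "3 * s \<le> h" "h = 2 ^ N / 2 ^ l"
  shows "\<lfloor>a / h\<rfloor> = \<lfloor>(a + s) / h\<rfloor> \<or> \<lfloor>(a - 2 ^ N / 3) / h\<rfloor> = \<lfloor>(a + s - 2 ^ N / 3) / h\<rfloor>"
proof (rule ccontr)
  assume neg: "\<not> ?thesis"
  have h: "0 < h" using assms by simp
  \<comment> \<open>Different floors at the endpoints mean that a grid point lies in the half-open
    interval from b, excluded, to b + s.\<close>
  have crossing: "\<exists>j. b < h * of_int j \<and> h * of_int j \<le> b + s" if "\<lfloor>b / h\<rfloor> \<noteq> \<lfloor>(b + s) / h\<rfloor>" for b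
  proof (intro exI[of _ "\<lfloor>(b + s) / h\<rfloor>"] conjI)
    have "\<lfloor>b / h\<rfloor> \<le> \<lfloor>(b + s) / h\<rfloor>" using assms h by (intro floor_mono divide_right_mono) auto
    then have "\<lfloor>b / h\<rfloor> < \<lfloor>(b + s) / h\<rfloor>" using that by simp
    then have "b / h < of_int \<lfloor>(b + s) / h\<rfloor>" by (simp add: floor_less_iff)
    then show "b < h * of_int \<lfloor>(b + s) / h\<rfloor>" using h by (simp add: field_simps)
    show "h * of_int \<lfloor>(b + s) / h\<rfloor> \<le> b + s"
      using floor_divide_lower[OF h, of "b + s"] by (simp add: mult.commute)
  qed
  obtain j where j: "a < h * of_int j" "h * of_int j \<le> a + s"
    using crossing[of a] neg by auto
  obtain j' where j': "a - 2 ^ N / 3 < h * of_int j'" "h * of_int j' \<le> a + s - 2 ^ N / 3"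
    using crossing[of "a - 2 ^ N / 3"] neg by (auto simp: algebra_simps)
  have N: "(2::real) ^ N = h * 2 ^ l" using assms by simp
  define d where "d = 3 * (j - j') - 2 ^ l"
  have "h * of_int d = 3 * (h * of_int j - (h * of_int j' + 2 ^ N / 3))"
    unfolding N by (simp add: d_def algebra_simps)
  moreover define u where "u = h * of_int j - (h * of_int j' + 2 ^ N / 3)"
  moreover have "u < s" "- s < u" using j j' unfolding u_def by linarith+
  ultimately have "\<bar>h * of_int d\<bar> < 3 * s" by simp
  then have "h * \<bar>of_int d\<bar> < h * 1" using assms h by (simp add: abs_mult)
  then have "\<bar>real_of_int d\<bar> < 1" using h by simp
  then have "d = 0" by linarith
  then have "(2::int) ^ l = 3 * (j - j')" by (simp add: d_def)
  then have "(3::int) dvd 2 ^ l" by simp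
  moreover have "coprime (3::int) (2 ^ l)" by simp
  ultimately show False using coprime_common_divisor[of "3::int" "2 ^ l" 3] by simp
qed

lemma measure_cube:
  fixes a :: "real ^ 'n"
  assumes "0 < s"
  shows "measure lebesgue (cbox a (a + s *\<^sub>R One)) = s ^ CARD('n)"
  using assms content_cbox_cart[of a "a + s *\<^sub>R One"] by (simp add: interval_ne_empty_cart)

lemma cube_subset_grid_cube:
  fixes a :: "real ^ 'n"
  assumes "0 < s" "3 * s \<le> 2 ^ N"
  obtains S R where "R \<in> grid N S" "cbox a (a + s *\<^sub>R One) \<subseteq> R"
    "measure lebesgue R \<le> 6 ^ CARD('n) * measure lebesgue (cbox a (a + s *\<^sub>R One))"
proof -
  \<comment> \<open>The scale is chosen so that the side 2^N / 2^l lies between 3s, as the one-third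
    trick demands, and 6s, which gives the volume ratio. The hypothesis on s makes l
    nonnegative.\<close>
  obtain l where l: "2 ^ l \<le> 2 ^ N / (3 * s)" "2 ^ N / (3 * s) < 2 ^ (l + 1)"
  proof -
    have "1 \<le> 2 ^ N / (3 * s)" using assms by simp
    define l where "l = nat \<lfloor>log 2 (2 ^ N / (3 * s))\<rfloor>"
    have "0 \<le> log 2 (2 ^ N / (3 * s))" using \<open>1 \<le> 2 ^ N / (3 * s)\<close> by simp
    then have "real l \<le> log 2 (2 ^ N / (3 * s))" "log 2 (2 ^ N / (3 * s)) < real (l + 1)"
      unfolding l_def by linarith+
    then show thesis
      using \<open>1 \<le> 2 ^ N / (3 * s)\<close> by (intro that[of l]) (auto simp: le_log_iff log_less_iff powr_realpow powr_add)
  qed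
  define h :: real where "h = 2 ^ N / 2 ^ l"
  have h: "0 < h" "3 * s \<le> h" "h \<le> 6 * s" using l assms by (auto simp: h_def field_simps)
  \<comment> \<open>Exactly those coordinates are shifted in which the unshifted grid cuts the side
    of the cube.\<close>
  define S where "S = {i. \<lfloor>(a $ i) / h\<rfloor> \<noteq> \<lfloor>(a $ i + s) / h\<rfloor>}"
  define \<tau> :: "real ^ 'n" where "\<tau> = (\<chi> i. if i \<in> S then 2 ^ N / 3 else 0)"
  define j :: "int ^ 'n" where "j = (\<chi> i. \<lfloor>(a $ i - \<tau> $ i) / h\<rfloor>)"
  define b where "b = \<tau> + h *\<^sub>R (\<chi> i. real_of_int (j $ i))"
  have same: "\<lfloor>(a $ i - \<tau> $ i) / h\<rfloor> = \<lfloor>(a $ i + s - \<tau> $ i) / h\<rfloor>" for i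
    using one_third_trick[OF assms(1) h(2) h_def, of "a $ i"] by (auto simp: \<tau>_def S_def)
  have sub: "cbox a (a + s *\<^sub>R One) \<subseteq> grid_cube h \<tau> j"
  proof
    fix x assume x: "x \<in> cbox a (a + s *\<^sub>R One)"
    have "\<lfloor>(x $ i - \<tau> $ i) / h\<rfloor> = j $ i" for i
    proof -
      have "a $ i \<le> x $ i" "x $ i \<le> a $ i + s" using x by (auto simp: mem_box_cart)
      then have "\<lfloor>(a $ i - \<tau> $ i) / h\<rfloor> \<le> \<lfloor>(x $ i - \<tau> $ i) / h\<rfloor>"
        "\<lfloor>(x $ i - \<tau> $ i) / h\<rfloor> \<le> \<lfloor>(a $ i + s - \<tau> $ i) / h\<rfloor>"
        using h by (auto intro!: floor_mono divide_right_mono)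
      then show ?thesis using same[of i] by (simp add: j_def)
    qed
    then show "x \<in> grid_cube h \<tau> j" by (simp add: grid_cube_def)
  qed
  have R: "grid_cube h \<tau> j \<in> grid N S" unfolding grid_def h_def \<tau>_def by auto
  have "measure lebesgue (grid_cube h \<tau> j) \<le> measure lebesgue (cbox b (b + h *\<^sub>R One))"
    unfolding b_def using grid_cube_between(2)[OF h(1)] closure_grid(3)[OF R]
    by (intro measure_mono_fmeasurable) auto
  also have "\<dots> \<le> (6 * s) ^ CARD('n)" unfolding measure_cube[OF h(1)] using h by (intro power_mono) auto
  also have "\<dots> = 6 ^ CARD('n) * measure lebesgue (cbox a (a + s *\<^sub>R One))"
    unfolding measure_cube[OF assms(1)] by (simp add: power_mult_distrib)
  finally show thesis by (rule that[OF R sub])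
qed

subsection \<open>The fractional maximal function\<close>

text \<open>The coefficient of Q in \<open>frac_maximal\<close> without its indicators; it also
  makes sense for the half-open grid cubes.\<close>

definition cube_term ::
    "nat \<Rightarrow> real \<Rightarrow> (nat \<Rightarrow> real ^ 'n \<Rightarrow> real) \<Rightarrow> (real ^ 'n) set \<Rightarrow> ennreal" where
  "cube_term m \<alpha> f Q = ennreal (measure lebesgue Q powr (\<alpha> / real CARD('n))) *
     (\<Prod>i = 1..m. (\<integral>\<^sup>+y\<in>Q. ennreal \<bar>f i y\<bar> \<partial>lebesgue) / ennreal (measure lebesgue Q))"

text \<open>A product of m indicators of Q collapses to one indicator because m is positive.\<close>

lemma frac_maximal_eq_family_max:
  assumes "1 \<le> m"
  shows "frac_maximal m \<alpha> f x = family_max cubes (cube_term m \<alpha> f) x"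
proof -
  have "(\<Prod>i = 1..m. indicator Q x / ennreal (measure lebesgue Q) * (\<integral>\<^sup>+y\<in>Q. ennreal \<bar>f i y\<bar> \<partial>lebesgue))
      = (\<Prod>i = 1..m. (\<integral>\<^sup>+y\<in>Q. ennreal \<bar>f i y\<bar> \<partial>lebesgue) / ennreal (measure lebesgue Q)) * indicator Q x" for Q
    using assms by (cases "x \<in> Q") (auto simp: divide_ennreal_def mult.commute)
  then show ?thesis
    by (simp add: frac_maximal_def family_max_def cube_term_def mult.assoc)
qed

text \<open>Each of the m averages loses at most the volume ratio c, and the fractional volume
  factor can only grow because \<alpha> is nonnegative.\<close>

lemma cube_term_le:
  assumes "0 \<le> \<alpha>" "Q \<subseteq> R" "0 < measure lebesgue Q" "measure lebesgue Q \<le> measure lebesgue R"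
    and c: "measure lebesgue R \<le> c * measure lebesgue Q"
  shows "cube_term m \<alpha> f Q \<le> ennreal (c ^ m) * cube_term m \<alpha> f R"
proof -
  let ?I = "\<lambda>Q i. \<integral>\<^sup>+y\<in>Q. ennreal \<bar>f i y\<bar> \<partial>lebesgue" and ?v = "measure lebesgue"
  have R: "0 < ?v R" using assms by linarith
  then have "0 < c * ?v Q" using c by linarith
  then have "0 < c" using assms by (simp add: zero_less_mult_iff)
  have "?I Q i / ennreal (?v Q) \<le> ennreal c * (?I R i / ennreal (?v R))" for i
  proof -
    have "?I Q i \<le> ?I R i"
      using assms(2) by (intro nn_integral_mono) (auto split: split_indicator)
    moreover have "1 / ?v Q \<le> c * (1 / ?v R)"
      using assms R by (simp add: field_simps)
    ultimately have "?I Q i * ennreal (1 / ?v Q) \<le> ?I R i * ennreal (c * (1 / ?v R))"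
      by (intro mult_mono ennreal_leI) auto
    also have "ennreal (c * (1 / ?v R)) = ennreal c * ennreal (1 / ?v R)"
      using R \<open>0 < c\<close> by (intro ennreal_mult) auto
    finally show ?thesis
      using assms(3) R by (simp add: divide_ennreal_def inverse_ennreal inverse_eq_divide mult.left_commute)
  qed
  then have "cube_term m \<alpha> f Q \<le> ennreal (?v R powr (\<alpha> / real CARD('a))) *
      (\<Prod>i = 1..m. ennreal c * (?I R i / ennreal (?v R)))"
    unfolding cube_term_def using assms
    by (intro mult_mono prod_mono_ennreal ennreal_leI powr_mono2) auto
  also have "\<dots> = ennreal (c ^ m) * cube_term m \<alpha> f R"
    using \<open>0 < c\<close> by (simp add: cube_term_def prod.distrib ennreal_power ac_simps)
  finally show ?thesis .
qed

lemma cubesE: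
  assumes "Q \<in> cubes"
  obtains a s where "0 < s" "Q = cbox a (a + s *\<^sub>R One)"
  using assms by (auto simp: cubes_def)

lemma measure_cubes_pos: "Q \<in> cubes \<Longrightarrow> 0 < measure lebesgue Q"
  by (erule cubesE) (simp only: measure_cube zero_less_power)

lemma sets_cubes [measurable_dest]: "Q \<in> cubes \<Longrightarrow> Q \<in> sets lebesgue"
  by (erule cubesE) simp

text \<open>Any cube contributing to the supremum at \<open>x\<close> can be enlarged slightly to contain \<open>x\<close> in its interior.\<close>

lemma open_frac_maximal_superlevel:
  fixes f :: "nat \<Rightarrow> real ^ 'n \<Rightarrow> real"
  assumes "1 \<le> m" "0 \<le> \<alpha>"
  shows "open {x. t < frac_maximal m \<alpha> f x}"
proof (subst open_subopen, intro ballI)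
  fix x assume "x \<in> {x. t < frac_maximal m \<alpha> f x}"
  then obtain Q where Q: "Q \<in> cubes" "x \<in> Q" "t < cube_term m \<alpha> f Q"
    using assms by (auto simp: frac_maximal_eq_family_max less_family_max_iff)
  obtain a s where s: "0 < s" "Q = cbox a (a + s *\<^sub>R One)" using Q(1) by (rule cubesE)
  \<comment> \<open>The strict inequality leaves room for a factor above 1, which pays for the
    enlargement. For t = 0 any such factor will do.\<close>
  obtain \<kappa> where \<kappa>: "1 < \<kappa>" "ennreal \<kappa> * t < cube_term m \<alpha> f Q"
  proof -
    obtain v where v: "t < v" "v < cube_term m \<alpha> f Q" using Q(3) dense by blast
    then obtain v' where v': "v = ennreal v'" "0 \<le> v'" by (cases v) auto
    obtain t' where t': "t = ennreal t'" "0 \<le> t'" "t' < v'"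
      using v v' by (cases t) (auto simp: ennreal_less_iff)
    show thesis
    proof (cases "t' = 0")
      case True
      then show thesis using that[of 2] Q(3) t' by simp
    next
      case False
      then have "1 < v' / t'" "ennreal (v' / t') * t = v"
        using t' v' by (auto simp flip: ennreal_mult)
      then show thesis using that v by blast
    qed
  qed
  \<comment> \<open>Scaling the side by \<rho> costs a volume ratio of \<rho>^CARD('n) in each of m
    averages, so \<rho> is chosen to make the total loss exactly \<kappa>.\<close>
  define n where "n = CARD('n) * m"
  have "0 < n" using assms by (simp add: n_def)
  define \<rho> where "\<rho> = root n \<kappa>"
  have \<rho>: "1 < \<rho>" "\<rho> ^ n = \<kappa>" using \<kappa> \<open>0 < n\<close> by (auto simp: \<rho>_def)
  \<comment> \<open>The enlarged cube is concentric with Q, and d is the margin gained on every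
    side.\<close>
  define d where "d = (\<rho> - 1) * s / 2"
  define b where "b = a - d *\<^sub>R One"
  define R where "R = cbox b (b + (\<rho> * s) *\<^sub>R One)"
  have "0 < \<rho> * s" using \<rho> s by simp
  then have R: "R \<in> cubes" unfolding cubes_def R_def by blast
  have d: "0 < d" "\<rho> * s = s + 2 * d" using \<rho> s by (simp_all add: d_def field_simps)
  have margin: "b $ i < a $ i" "a $ i + s < b $ i + \<rho> * s" for i
    using d by (simp_all add: b_def)
  have sub: "Q \<subseteq> box b (b + (\<rho> * s) *\<^sub>R One)"
  proof
    fix y assume "y \<in> Q"
    then have y: "a $ i \<le> y $ i" "y $ i \<le> a $ i + s" for i by (auto simp: s(2) mem_box_cart)
    have "b $ i < y $ i" "y $ i < b $ i + \<rho> * s" for i using margin[of i] y[of i] by linarith+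
    then show "y \<in> box b (b + (\<rho> * s) *\<^sub>R One)" by (simp add: mem_box_cart)
  qed
  have "measure lebesgue R = \<rho> ^ CARD('n) * measure lebesgue Q"
    using \<rho> s unfolding R_def s(2) by (simp only: measure_cube power_mult_distrib mult_pos_pos zero_less_one less_trans)
  moreover have "1 \<le> \<rho> ^ CARD('n)" using \<rho> by simp
  ultimately have "cube_term m \<alpha> f Q \<le> ennreal ((\<rho> ^ CARD('n)) ^ m) * cube_term m \<alpha> f R"
    using assms sub box_subset_cbox[of b] measure_cubes_pos[OF Q(1)] unfolding R_def
    by (intro cube_term_le) auto
  also have "(\<rho> ^ CARD('n)) ^ m = \<kappa>" using \<rho>(2) by (simp add: n_def power_mult)
  finally have "ennreal \<kappa> * t < ennreal \<kappa> * cube_term m \<alpha> f R" using \<kappa>(2) by simp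
  then have "t < cube_term m \<alpha> f R" by (metis mult_left_mono not_le zero_le)
  then have "box b (b + (\<rho> * s) *\<^sub>R One) \<subseteq> {x. t < frac_maximal m \<alpha> f x}"
    using R box_subset_cbox[of b] assms
    by (auto simp: frac_maximal_eq_family_max less_family_max_iff R_def)
  then show "\<exists>T. open T \<and> x \<in> T \<and> T \<subseteq> {x. t < frac_maximal m \<alpha> f x}"
    using sub Q(2) by blast
qed

lemma borel_measurable_frac_maximal:
  assumes "1 \<le> m" "0 \<le> \<alpha>"
  shows "frac_maximal m \<alpha> f \<in> borel_measurable lebesgue"
proof (rule borel_measurableI_greater)
  fix t
  have "{x. t < frac_maximal m \<alpha> f x} \<in> sets lebesgue"
    by (intro sets_completionI_sets) (simp add: borel_open open_frac_maximal_superlevel[OF assms])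
  then show "{x \<in> space lebesgue. t < frac_maximal m \<alpha> f x} \<in> sets lebesgue" by simp
qed

lemma set_nn_integral_closure:
  fixes Q :: "(real ^ 'n) set"
  assumes "negligible (closure Q - Q)"
  shows "(\<integral>\<^sup>+x\<in>closure Q. f x \<partial>lebesgue) = (\<integral>\<^sup>+x\<in>Q. f x \<partial>lebesgue)"
proof (rule nn_integral_cong_AE)
  have "AE x in lebesgue. x \<notin> closure Q - Q"
    using assms by (intro AE_not_in) (simp add: negligible_iff_null_sets)
  then show "AE x in lebesgue. f x * indicator (closure Q) x = f x * indicator Q x"
    by eventually_elim (use closure_subset[of Q] in \<open>auto split: split_indicator\<close>)
qed

lemma measure_closure:
  fixes Q :: "(real ^ 'n) set"
  assumes "negligible (closure Q - Q)" "Q \<in> sets lebesgue"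
  shows "measure lebesgue (closure Q) = measure lebesgue Q"
  using set_nn_integral_closure[OF assms(1), of "\<lambda>_. 1"] assms(2)
  by (simp add: measure_def)

lemma cube_term_closure:
  fixes Q :: "(real ^ 'n) set"
  assumes "negligible (closure Q - Q)" "Q \<in> sets lebesgue"
  shows "cube_term m \<alpha> f (closure Q) = cube_term m \<alpha> f Q"
  by (simp add: cube_term_def set_nn_integral_closure[OF assms(1)] measure_closure[OF assms])

section \<open>Weights, their measures and the dual weights\<close>

lemma weight_measurable:
  fixes u :: "real ^ 'n \<Rightarrow> real"
  assumes "weight u"
  shows "u \<in> borel_measurable lebesgue"
proof (rule borel_measurable_LIMSEQ_real)
  fix k :: nat
  have "set_integrable lebesgue (cball 0 (real k)) u"
    using assms by (simp add: weight_def)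
  then show "(\<lambda>x. indicator (cball 0 (real k)) x * u x) \<in> borel_measurable lebesgue"
    by (auto simp: set_integrable_def dest: borel_measurable_integrable)
next
  fix x :: "real ^ 'n"
  obtain k0 where k0: "norm x \<le> real k0" using real_arch_simple by blast
  have "\<forall>\<^sub>F k in sequentially. indicator (cball 0 (real k)) x * u x = u x"
    using eventually_ge_at_top[of k0] by eventually_elim (use k0 in \<open>auto simp: indicator_def\<close>)
  then show "(\<lambda>k. indicator (cball 0 (real k)) x * u x) \<longlonglongrightarrow> u x"
    by (rule tendsto_eventually)
qed

abbreviation weight_measure :: "(real ^ 'n \<Rightarrow> real) \<Rightarrow> (real ^ 'n) measure" where
  "weight_measure u \<equiv> density lebesgue (\<lambda>x. ennreal (u x))"

text \<open>Positivity and finiteness of \<sigma>(Q) justify cancelling it later; the last clause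
  translates the Lebesgue integral in \<open>sawyer_const\<close> into the measure \<sigma>
  dx.\<close>

lemma weight_cube:
  fixes u :: "real ^ 'n \<Rightarrow> real"
  assumes u: "weight u" and Q: "Q \<in> cubes"
  shows "emeasure (weight_measure u) Q \<noteq> 0" "emeasure (weight_measure u) Q \<noteq> top"
    "ennreal ((LINT x:Q|lebesgue. u x) powr r) = ennpowr (emeasure (weight_measure u) Q) r"
proof -
  note [measurable] = weight_measurable[OF u] sets_cubes[OF Q]
  have pos: "AE x in lebesgue. 0 < u x" using u by (simp add: weight_def)
  have em: "emeasure (weight_measure u) Q = (\<integral>\<^sup>+x\<in>Q. ennreal (u x) \<partial>lebesgue)"
    by (simp add: emeasure_density)
  show "emeasure (weight_measure u) Q \<noteq> 0"
  proof
    assume "emeasure (weight_measure u) Q = 0"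
    then have "AE x in lebesgue. ennreal (u x) * indicator Q x = 0"
      unfolding em by (subst (asm) nn_integral_0_iff_AE) auto
    with pos have "AE x in lebesgue. x \<notin> Q"
      by eventually_elim (auto split: split_indicator_asm simp: ennreal_eq_0_iff)
    then have "emeasure lebesgue Q = 0"
      by (subst (asm) AE_iff_measurable[OF _ refl]) auto
    then show False using measure_cubes_pos[OF Q] by (simp add: measure_def)
  qed
  have "compact Q" using Q by (rule cubesE) simp
  then have int: "integrable lebesgue (\<lambda>x. indicator Q x * u x)"
    using u by (auto simp: weight_def set_integrable_def)
  have "ennreal (LINT x|lebesgue. indicator Q x * u x) = (\<integral>\<^sup>+x. ennreal (indicator Q x * u x) \<partial>lebesgue)"
    using pos by (intro nn_integral_eq_integral[symmetric] int) (auto elim!: eventually_mono)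
  also have "\<dots> = emeasure (weight_measure u) Q"
    unfolding em by (intro nn_integral_cong) (auto split: split_indicator)
  finally have eq: "ennreal (LINT x:Q|lebesgue. u x) = emeasure (weight_measure u) Q"
    by (simp add: set_lebesgue_integral_def)
  then show "emeasure (weight_measure u) Q \<noteq> top" by (metis ennreal_neq_top)
  have "0 \<le> (LINT x:Q|lebesgue. u x)"
    unfolding set_lebesgue_integral_def using pos by (intro integral_nonneg_AE) (auto elim!: eventually_mono)
  then show "ennreal ((LINT x:Q|lebesgue. u x) powr r) = ennpowr (emeasure (weight_measure u) Q) r"
    unfolding eq[symmetric] by (simp add: ennpowr_ennreal)
qed

lemma dual_weight_eq: "1 < r \<Longrightarrow> dual_weight r \<sigma> x = \<sigma> x powr (1 - r)"
  by (simp add: dual_weight_def conj_exponent_def)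

text \<open>Pointwise form of the isometry f = g \<sigma>: since -r/r' = 1 - r, the norm of f with
  the dual weight is the norm of g = |f|/\<sigma> with respect to \<sigma> dx.\<close>

lemma dual_weight_pairing:
  assumes "1 < r" "0 < \<sigma> x"
  shows "ennpowr (ennreal \<bar>y\<bar> / ennreal (\<sigma> x)) r * ennreal (\<sigma> x)
    = ennpowr (ennreal \<bar>y\<bar>) r * ennreal (dual_weight r \<sigma> x)"
proof -
  have "(\<bar>y\<bar> / \<sigma> x) powr r * \<sigma> x = \<bar>y\<bar> powr r * \<sigma> x powr (1 - r)"
    using assms by (simp add: powr_divide powr_diff)
  then show ?thesis
    using assms by (simp add: divide_ennreal ennpowr_ennreal dual_weight_eq flip: ennreal_mult)
qed

section \<open>Necessity of the testing condition\<close>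

text \<open>For f_i = \<sigma> times the indicator of Q, the identity \<sigma>^r \<sigma>^(1-r) =
  \<sigma> makes each norm \<sigma>(Q)^(1/P i). These multiply to \<sigma>(Q)^(1/p), the denominator
  of the testing quotient.\<close>

lemma sawyer_const_le:
  fixes \<sigma> \<omega> :: "real ^ 'n \<Rightarrow> real"
  assumes "1 \<le> m" and P: "\<And>i. i \<in> {1..m} \<Longrightarrow> 1 < P i" "1 / p = (\<Sum>i = 1..m. 1 / P i)" and "0 < q"
    and \<sigma>: "weight \<sigma>" and K: "maximal_bound m \<alpha> P q \<sigma> \<omega> K"
  shows "sawyer_const m \<alpha> p q \<sigma> \<omega> \<le> K"
  unfolding sawyer_const_def
proof (rule SUP_least)
  fix Q :: "(real ^ 'n) set" assume Q: "Q \<in> cubes"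
  note [measurable] = weight_measurable[OF \<sigma>] sets_cubes[OF Q]
  have pos: "AE x in lebesgue. 0 < \<sigma> x" using \<sigma> by (simp add: weight_def)
  let ?s = "emeasure (weight_measure \<sigma>) Q"
  define f where "f = (\<lambda>(i::nat) y. \<sigma> y * indicator Q y)"
  have pair: "AE x in lebesgue. ennpowr (ennreal \<bar>f i x\<bar>) r * ennreal (dual_weight r \<sigma> x)
      = ennreal (\<sigma> x) * indicator Q x" if "1 < r" for r i
    using pos
  proof eventually_elim
    case (elim x)
    have "\<sigma> x powr r * \<sigma> x powr (1 - r) = \<sigma> x" using elim by (simp flip: powr_add)
    then show ?case
      using that elim by (simp add: f_def dual_weight_eq ennpowr_ennreal flip: ennreal_mult split: split_indicator)
  qed
  have int: "(\<integral>\<^sup>+x. ennpowr (ennreal \<bar>f i x\<bar>) r * ennreal (dual_weight r \<sigma> x) \<partial>lebesgue) = ?s" if "1 < r" for r i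
    using nn_integral_cong_AE[OF pair[OF that, of i]] by (simp add: emeasure_density)
  have "f \<in> dual_tuples m P \<sigma>"
    unfolding dual_tuples_def Lp_space_def
  proof (safe)
    fix i assume i: "i \<in> {1..m}"
    show "f i \<in> borel_measurable lebesgue" unfolding f_def by measurable
    have "(\<integral>\<^sup>+x. ennreal (\<bar>f i x\<bar> powr P i * dual_weight (P i) \<sigma> x) \<partial>lebesgue) = ?s"
      using int[OF P(1)[OF i], of i] by (simp add: ennpowr_ennreal ennreal_mult dual_weight_def)
    then show "(\<integral>\<^sup>+x. ennreal (\<bar>f i x\<bar> powr P i * dual_weight (P i) \<sigma> x) \<partial>lebesgue) < \<infinity>"
      using weight_cube(2)[OF \<sigma> Q] by (simp add: top.not_eq_extremum)
  qed
  then have "Lp_norm q \<omega> (frac_maximal m \<alpha> f) \<le> K * (\<Prod>i = 1..m. Lp_norm (P i) (dual_weight (P i) \<sigma>) (\<lambda>x. ennreal \<bar>f i x\<bar>))"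
    using K by (simp add: maximal_bound_def)
  also have "(\<Prod>i = 1..m. Lp_norm (P i) (dual_weight (P i) \<sigma>) (\<lambda>x. ennreal \<bar>f i x\<bar>)) = (\<Prod>i = 1..m. ennpowr ?s (1 / P i))"
    unfolding Lp_norm_def using P(1) by (intro prod.cong) (auto simp: int)
  also have "\<dots> = ennpowr ?s (1 / p)"
    unfolding P(2) using \<open>1 \<le> m\<close> by (intro ennpowr_sum_exponents) auto
  finally have "Lp_norm q \<omega> (frac_maximal m \<alpha> f) \<le> K * ennpowr ?s (1 / p)" .
  moreover have "ennpowr (\<integral>\<^sup>+x\<in>Q. ennpowr (frac_maximal m \<alpha> f x) q * ennreal (\<omega> x) \<partial>lebesgue) (1 / q)
      \<le> Lp_norm q \<omega> (frac_maximal m \<alpha> f)"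
    unfolding Lp_norm_def using \<open>0 < q\<close>
    by (intro ennpowr_mono nn_integral_mono) (auto split: split_indicator)
  ultimately have "ennpowr (\<integral>\<^sup>+x\<in>Q. ennpowr (frac_maximal m \<alpha> f x) q * ennreal (\<omega> x) \<partial>lebesgue) (1 / q)
      / ennpowr ?s (1 / p) \<le> K * ennpowr ?s (1 / p) / ennpowr ?s (1 / p)"
    by (intro divide_right_mono_ennreal) simp
  also have "\<dots> = K"
    using weight_cube(1,2)[OF \<sigma> Q] by (intro mult_divide_eq_ennreal) auto
  finally show "ennpowr (\<integral>\<^sup>+x\<in>Q. ennpowr (frac_maximal m \<alpha> (\<lambda>i y. \<sigma> y * indicator Q y) x) q
      * ennreal (\<omega> x) \<partial>lebesgue) (1 / q) / ennreal ((LINT x:Q|lebesgue. \<sigma> x) powr (1 / p)) \<le> K"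
    by (simp add: weight_cube(3)[OF \<sigma> Q] f_def)
qed

section \<open>Sufficiency of the testing condition\<close>

lemma sawyer_testing:
  fixes \<sigma> \<omega> :: "real ^ 'n \<Rightarrow> real"
  assumes \<sigma>: "weight \<sigma>" and Q: "Q \<in> cubes" and "0 < q"
  shows "(\<integral>\<^sup>+x\<in>Q. ennpowr (frac_maximal m \<alpha> (\<lambda>i y. \<sigma> y * indicator Q y) x) q * ennreal (\<omega> x) \<partial>lebesgue)
    \<le> ennpowr (sawyer_const m \<alpha> p q \<sigma> \<omega>) q * ennpowr (emeasure (weight_measure \<sigma>) Q) (q / p)"
    (is "?I \<le> ennpowr ?S q * _")
proof -
  let ?Y = "ennpowr (emeasure (weight_measure \<sigma>) Q) (1 / p)"
  have Y: "?Y \<noteq> 0" "?Y \<noteq> top" using weight_cube(1,2)[OF \<sigma> Q] by auto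
  have "ennpowr ?I (1 / q) / ?Y \<le> ?S"
    unfolding sawyer_const_def weight_cube(3)[OF \<sigma> Q, symmetric] using Q by (rule SUP_upper)
  then have "ennpowr ?I (1 / q) / ?Y * ?Y \<le> ?S * ?Y" by (rule mult_right_mono) simp
  also have "ennpowr ?I (1 / q) / ?Y * ?Y = ennpowr ?I (1 / q)"
    using Y by (simp add: ennreal_divide_times ennreal_divide_self flip: zero_less_iff_neq_zero top.not_eq_extremum)
  finally have "ennpowr (ennpowr ?I (1 / q)) q \<le> ennpowr (?S * ?Y) q"
    using \<open>0 < q\<close> by (intro ennpowr_mono) auto
  then show ?thesis using \<open>0 < q\<close> by (simp add: ennpowr_ennpowr ennpowr_mult)
qed

text \<open>The embedding theorem is applied to g_i = |f_i|/\<sigma>, with \<sigma> dx as the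
  measure of the means and \<omega> dx as the target. The bound is the same for all N and S.\<close>

lemma grid_bound:
  fixes \<sigma> \<omega> :: "real ^ 'n \<Rightarrow> real" and m :: nat
  assumes "1 \<le> m" and P: "\<And>i. i \<in> {1..m} \<Longrightarrow> 1 < P i" "1 / p = (\<Sum>i = 1..m. 1 / P i)" "p \<le> q"
    and \<sigma>: "weight \<sigma>" and \<omega>: "weight \<omega>" and f: "f \<in> dual_tuples m P \<sigma>"
  shows "(\<integral>\<^sup>+x. ennpowr (family_max (grid N (S :: 'n set)) (cube_term m \<alpha> f) x) q \<partial>weight_measure \<omega>)
    \<le> ennreal (embedding_const {1..m} P p q) * ennpowr (sawyer_const m \<alpha> p q \<sigma> \<omega>) q *
      (\<Prod>i = 1..m. ennpowr (Lp_norm (P i) (dual_weight (P i) \<sigma>) (\<lambda>x. ennreal \<bar>f i x\<bar>)) q)"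
proof -
  let ?M = "weight_measure \<sigma>" and ?N = "weight_measure \<omega>" and ?D = "grid N S"
  note [measurable] = weight_measurable[OF \<sigma>] weight_measurable[OF \<omega>]
  have pos: "AE x in lebesgue. 0 < \<sigma> x" using \<sigma> by (simp add: weight_def)
  have "0 < 1 / p" unfolding P(2) using \<open>1 \<le> m\<close> P(1) by (intro sum_pos) (auto intro: order.strict_trans[of 0 1])
  then have q: "0 < q" using P(3) by simp
  define g where "g i x = ennreal \<bar>f i x\<bar> / ennreal (\<sigma> x)" for i x
  define A where "A = cube_term m \<alpha> (\<lambda>_. \<sigma>)"
  have f_meas [measurable]: "f i \<in> borel_measurable lebesgue" if "i \<in> {1..m}" for i
    using f that by (auto simp: dual_tuples_def Lp_space_def)
  have g_meas: "g i \<in> borel_measurable ?M" if "i \<in> {1..m}" for i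
    using f_meas[OF that] unfolding g_def by measurable
  have em: "emeasure ?M Q = (\<integral>\<^sup>+x\<in>Q. ennreal (\<sigma> x) \<partial>lebesgue)" if "Q \<in> sets lebesgue" for Q
    using that by (simp add: emeasure_density)
  have em_abs: "emeasure ?M Q = (\<integral>\<^sup>+x\<in>Q. ennreal \<bar>\<sigma> x\<bar> \<partial>lebesgue)" if "Q \<in> sets lebesgue" for Q
    unfolding em[OF that] using pos by (intro nn_integral_cong_AE) (auto elim!: eventually_mono)
  have em_closure: "emeasure ?M (closure Q) = emeasure ?M Q" if "Q \<in> ?D" for Q
    using set_nn_integral_closure[OF closure_grid(2)[OF that]] closure_grid(3)[OF that] by (simp add: em)
  have em_grid: "emeasure ?M Q \<noteq> 0" "emeasure ?M Q \<noteq> top" if "Q \<in> ?D" for Q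
    using weight_cube(1,2)[OF \<sigma> closure_grid(1)[OF that]] em_closure[OF that] by auto
  have norm_g: "(\<integral>\<^sup>+x. ennpowr (g i x) (P i) \<partial>?M)
      = (\<integral>\<^sup>+x. ennpowr (ennreal \<bar>f i x\<bar>) (P i) * ennreal (dual_weight (P i) \<sigma> x) \<partial>lebesgue)"
    if "i \<in> {1..m}" for i
  proof -
    have [measurable]: "g i \<in> borel_measurable lebesgue" using g_meas[OF that] by simp
    have "(\<integral>\<^sup>+x. ennpowr (g i x) (P i) \<partial>?M) = (\<integral>\<^sup>+x. ennreal (\<sigma> x) * ennpowr (g i x) (P i) \<partial>lebesgue)"
      by (subst nn_integral_density) auto
    also have "\<dots> = (\<integral>\<^sup>+x. ennpowr (ennreal \<bar>f i x\<bar>) (P i) * ennreal (dual_weight (P i) \<sigma> x) \<partial>lebesgue)"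
      using pos
      by (intro nn_integral_cong_AE, eventually_elim)
        (use P(1)[OF that] in \<open>simp add: g_def dual_weight_pairing mult.commute[of "ennreal (\<sigma> _)"]\<close>)
    finally show ?thesis .
  qed
  have mean_g: "(\<integral>\<^sup>+x\<in>Q. g i x \<partial>?M) = (\<integral>\<^sup>+x\<in>Q. ennreal \<bar>f i x\<bar> \<partial>lebesgue)"
    if "i \<in> {1..m}" "Q \<in> sets lebesgue" for i Q
  proof -
    have [measurable]: "g i \<in> borel_measurable lebesgue" "Q \<in> sets lebesgue"
      using g_meas[OF that(1)] that(2) by simp_all
    have "(\<integral>\<^sup>+x\<in>Q. g i x \<partial>?M) = (\<integral>\<^sup>+x. ennreal (\<sigma> x) * (g i x * indicator Q x) \<partial>lebesgue)"
      by (subst nn_integral_density) auto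
    also have "\<dots> = (\<integral>\<^sup>+x\<in>Q. ennreal \<bar>f i x\<bar> \<partial>lebesgue)"
    proof (intro nn_integral_cong_AE, use pos in eventually_elim)
      case (elim x)
      then have "ennreal (\<sigma> x) * g i x = ennreal \<bar>f i x\<bar>"
        by (simp add: g_def divide_ennreal flip: ennreal_mult)
      then show ?case by (simp flip: mult.assoc)
    qed
    finally show ?thesis .
  qed
  \<comment> \<open>In each variable the average of \<sigma> contained in \<open>A Q\<close> cancels
    the denominator of the mean of g_i.\<close>
  have cube_term: "cube_term m \<alpha> f Q = A Q * (\<Prod>i = 1..m. mean ?M (g i) Q)" if Q: "Q \<in> ?D" for Q
  proof -
    have *: "a / v * (c / a) = c / v" if "a \<noteq> 0" "a \<noteq> top" for a c v :: ennreal
    proof -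
      have "a / v * (c / a) = (a / a) * (c / v)" by (simp add: divide_ennreal_def ac_simps)
      then show ?thesis
        using that by (simp add: ennreal_divide_self flip: zero_less_iff_neq_zero top.not_eq_extremum)
    qed
    show ?thesis
      unfolding A_def cube_term_def mult.assoc prod.distrib[symmetric]
      using em_grid[OF Q] closure_grid(3)[OF Q] by (simp add: mean_g * flip: em_abs)
  qed
  have "(\<integral>\<^sup>+x. ennpowr (family_max ?D (cube_term m \<alpha> f) x) q \<partial>?N)
      = (\<integral>\<^sup>+x. ennpowr (family_max ?D (\<lambda>Q. A Q * (\<Prod>i = 1..m. mean ?M (g i) Q)) x) q \<partial>?N)"
    by (simp add: family_max_def cube_term)
  also have "\<dots> \<le> ennreal (embedding_const {1..m} P p q) * ennpowr (sawyer_const m \<alpha> p q \<sigma> \<omega>) q *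
      (\<Prod>i = 1..m. ennpowr (\<integral>\<^sup>+x. ennpowr (g i x) (P i) \<partial>?M) (q / P i))"
  proof (rule multilinear_laminar_embedding[OF countable_grid laminar_grid])
    fix i assume i: "i \<in> {1..m}"
    have "(\<integral>\<^sup>+x. ennreal (\<bar>f i x\<bar> powr P i * dual_weight (P i) \<sigma> x) \<partial>lebesgue) < \<infinity>"
      using f i by (auto simp: dual_tuples_def Lp_space_def)
    then show "(\<integral>\<^sup>+x. ennpowr (g i x) (P i) \<partial>?M) \<noteq> top"
      by (simp add: norm_g[OF i] ennpowr_ennreal dual_weight_def ennreal_mult)
  next
    fix R assume R: "R \<in> ?D"
    let ?f = "\<lambda>(i::nat) y. \<sigma> y * indicator (closure R) y"
    \<comment> \<open>Cutting \<sigma> off outside the closure of R does not affect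
      \<open>A Q\<close> for Q inside R, so the localised family is dominated by the maximal
      function in the testing condition.\<close>
    have le: "family_max {Q \<in> ?D. Q \<subseteq> R} A x \<le> frac_maximal m \<alpha> ?f x * indicator (closure R) x" for x
    proof (rule family_max_leI)
      fix Q assume "Q \<in> {Q \<in> ?D. Q \<subseteq> R}" and x: "x \<in> Q"
      then have Q: "Q \<in> ?D" "Q \<subseteq> R" by auto
      have "A Q = cube_term m \<alpha> (\<lambda>_. \<sigma>) (closure Q)"
        unfolding A_def using cube_term_closure[OF closure_grid(2,3)[OF Q(1)]] by simp
      also have "\<dots> = cube_term m \<alpha> ?f (closure Q)"
      proof -
        have "(\<integral>\<^sup>+y\<in>closure Q. ennreal \<bar>\<sigma> y * indicator (closure R) y\<bar> \<partial>lebesgue)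
            = (\<integral>\<^sup>+y\<in>closure Q. ennreal \<bar>\<sigma> y\<bar> \<partial>lebesgue)"
          using closure_mono[OF Q(2)] by (intro nn_integral_cong) (auto split: split_indicator)
        then show ?thesis by (simp only: cube_term_def)
      qed
      also have "\<dots> \<le> frac_maximal m \<alpha> ?f x"
        unfolding frac_maximal_eq_family_max[OF \<open>1 \<le> m\<close>]
        using closure_grid(1)[OF Q(1)] closure_subset x by (intro family_max_upper) auto
      finally show "A Q \<le> frac_maximal m \<alpha> ?f x * indicator (closure R) x"
        using closure_subset[of R] Q x by (auto split: split_indicator)
    qed
    have D: "{Q \<in> ?D. Q \<subseteq> R} \<subseteq> sets lebesgue" using closure_grid(3) by auto
    have "countable {Q \<in> ?D. Q \<subseteq> R}" by (rule countable_subset[OF _ countable_grid[of N S]]) auto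
    note [measurable] = borel_measurable_family_max[OF this D]
    have "(\<integral>\<^sup>+x. ennpowr (family_max {Q \<in> ?D. Q \<subseteq> R} A x) q \<partial>?N)
        = (\<integral>\<^sup>+x. ennreal (\<omega> x) * ennpowr (family_max {Q \<in> ?D. Q \<subseteq> R} A x) q \<partial>lebesgue)"
      by (subst nn_integral_density) auto
    also have "\<dots> \<le> (\<integral>\<^sup>+x\<in>closure R. ennpowr (frac_maximal m \<alpha> ?f x) q * ennreal (\<omega> x) \<partial>lebesgue)"
    proof (rule nn_integral_mono)
      fix x
      have "ennpowr (family_max {Q \<in> ?D. Q \<subseteq> R} A x) q \<le> ennpowr (frac_maximal m \<alpha> ?f x) q * indicator (closure R) x"
        using ennpowr_mono[OF le[of x], of q] q by (simp add: ennpowr_mult)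
      then have "ennreal (\<omega> x) * ennpowr (family_max {Q \<in> ?D. Q \<subseteq> R} A x) q
        \<le> ennreal (\<omega> x) * (ennpowr (frac_maximal m \<alpha> ?f x) q * indicator (closure R) x)"
        by (rule mult_left_mono) simp
      then show "ennreal (\<omega> x) * ennpowr (family_max {Q \<in> ?D. Q \<subseteq> R} A x) q
        \<le> ennpowr (frac_maximal m \<alpha> ?f x) q * ennreal (\<omega> x) * indicator (closure R) x"
        by (simp add: ac_simps)
    qed
    also have "\<dots> \<le> ennpowr (sawyer_const m \<alpha> p q \<sigma> \<omega>) q * ennpowr (emeasure ?M (closure R)) (q / p)"
      by (rule sawyer_testing[OF \<sigma> closure_grid(1)[OF R] q])
    finally show "(\<integral>\<^sup>+x. ennpowr (family_max {Q \<in> ?D. Q \<subseteq> R} A x) q \<partial>?N)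
        \<le> ennpowr (sawyer_const m \<alpha> p q \<sigma> \<omega>) q * ennpowr (emeasure ?M R) (q / p)"
      by (simp add: em_closure[OF R])
  qed (use \<open>1 \<le> m\<close> P em_grid g_meas closure_grid(3) in auto)
  also have "(\<Prod>i = 1..m. ennpowr (\<integral>\<^sup>+x. ennpowr (g i x) (P i) \<partial>?M) (q / P i))
      = (\<Prod>i = 1..m. ennpowr (Lp_norm (P i) (dual_weight (P i) \<sigma>) (\<lambda>x. ennreal \<bar>f i x\<bar>)) q)"
    unfolding Lp_norm_def by (intro prod.cong) (auto simp: norm_g ennpowr_ennpowr)
  finally show ?thesis .
qed

text \<open>For large N a given cube lies in a comparable cube of one of the grids. Summing over S
  avoids naming which; a lower limit suffices because the threshold for N depends on the cube, and
  it suits Fatou's lemma.\<close>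

lemma frac_maximal_le_liminf_grid:
  fixes f :: "nat \<Rightarrow> real ^ 'n \<Rightarrow> real" and m :: nat
  assumes "1 \<le> m" "0 \<le> \<alpha>" "0 < q"
  shows "ennpowr (frac_maximal m \<alpha> f x) q \<le> liminf (\<lambda>N. \<Sum>S\<in>(UNIV :: 'n set set).
      ennreal (((6 ^ CARD('n)) ^ m) powr q) * ennpowr (family_max (grid N S) (cube_term m \<alpha> f) x) q)"
  unfolding frac_maximal_eq_family_max[OF assms(1)] ennpowr_family_max[OF assms(3), of cubes]
proof (rule family_max_leI)
  fix Q :: "(real ^ 'n) set" assume Q: "Q \<in> cubes" "x \<in> Q"
  obtain a s where s: "0 < s" "Q = cbox a (a + s *\<^sub>R One)" using Q(1) by (rule cubesE)
  \<comment> \<open>The one-third trick reaches cubes of side at most a third of 2^N, so this cube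
    is captured from N0 on.\<close>
  obtain N0 where "3 * s < 2 ^ N0" using real_arch_pow[of 2 "3 * s"] by auto
  show "ennpowr (cube_term m \<alpha> f Q) q \<le> liminf (\<lambda>N. \<Sum>S\<in>(UNIV :: 'n set set).
      ennreal (((6 ^ CARD('n)) ^ m) powr q) * ennpowr (family_max (grid N S) (cube_term m \<alpha> f) x) q)"
  proof (rule Liminf_bounded)
    show "\<forall>\<^sub>F N in sequentially. ennpowr (cube_term m \<alpha> f Q) q \<le> (\<Sum>S\<in>(UNIV :: 'n set set).
      ennreal (((6 ^ CARD('n)) ^ m) powr q) * ennpowr (family_max (grid N S) (cube_term m \<alpha> f) x) q)"
      using eventually_ge_at_top[of N0]
    proof eventually_elim
      case (elim N)
      have "(2::real) ^ N0 \<le> 2 ^ N" using elim by (intro power_increasing) auto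
      then have "3 * s \<le> 2 ^ N" using \<open>3 * s < 2 ^ N0\<close> by linarith
      then obtain S R where R: "R \<in> grid N S" "Q \<subseteq> R"
        "measure lebesgue R \<le> 6 ^ CARD('n) * measure lebesgue Q"
        using cube_subset_grid_cube[OF s(1), of N a] unfolding s(2) by metis
      have "measure lebesgue Q \<le> measure lebesgue (closure R)"
        using R(2) closure_subset[of R] closure_grid(1)[OF R(1)] sets_cubes[OF Q(1)]
        by (intro measure_mono_fmeasurable) (auto elim!: cubesE)
      then have "measure lebesgue Q \<le> measure lebesgue R"
        using measure_closure[OF closure_grid(2,3)[OF R(1)]] by simp
      then have "cube_term m \<alpha> f Q \<le> ennreal ((6 ^ CARD('n)) ^ m) * cube_term m \<alpha> f R"
        using assms(2) R measure_cubes_pos[OF Q(1)] by (intro cube_term_le) auto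
      also have "\<dots> \<le> ennreal ((6 ^ CARD('n)) ^ m) * family_max (grid N S) (cube_term m \<alpha> f) x"
        using R Q by (intro mult_left_mono family_max_upper) auto
      finally have "ennpowr (cube_term m \<alpha> f Q) q
          \<le> ennpowr (ennreal ((6 ^ CARD('n)) ^ m) * family_max (grid N S) (cube_term m \<alpha> f) x) q"
        using assms(3) by (intro ennpowr_mono) auto
      also have "\<dots> = ennreal (((6 ^ CARD('n)) ^ m) powr q) * ennpowr (family_max (grid N S) (cube_term m \<alpha> f) x) q"
        by (simp only: ennpowr_mult ennpowr_ennreal zero_le_power zero_le_numeral)
      also have "\<dots> \<le> (\<Sum>S\<in>(UNIV :: 'n set set).
          ennreal (((6 ^ CARD('n)) ^ m) powr q) * ennpowr (family_max (grid N S) (cube_term m \<alpha> f) x) q)"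
        by (rule member_le_sum) auto
      finally show ?case .
    qed
  qed
qed

text \<open>In \<open>C\<close>, the power of 2 counts the grids, the power of 6 is the volume loss
  in m averages, and the exponent 1/q returns from the q-th power of the norm.\<close>

lemma maximal_bound_sawyer_const:
  fixes \<sigma> \<omega> :: "real ^ 'n \<Rightarrow> real" and m :: nat
  assumes "1 \<le> m" and P: "\<And>i. i \<in> {1..m} \<Longrightarrow> 1 < P i" "1 / p = (\<Sum>i = 1..m. 1 / P i)" "p \<le> q"
    and "0 \<le> \<alpha>" and \<sigma>: "weight \<sigma>" and \<omega>: "weight \<omega>"
  defines "C \<equiv> (2 ^ CARD('n) * (((6 ^ CARD('n)) ^ m) powr q * embedding_const {1..m} P p q)) powr (1 / q)"
  shows "maximal_bound m \<alpha> P q \<sigma> \<omega> (ennreal C * sawyer_const m \<alpha> p q \<sigma> \<omega>)"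
  unfolding maximal_bound_def
proof
  fix f assume f: "f \<in> dual_tuples m P \<sigma>"
  note [measurable] = weight_measurable[OF \<omega>]
    borel_measurable_frac_maximal[OF \<open>1 \<le> m\<close> \<open>0 \<le> \<alpha>\<close>, of f]
  have "0 < 1 / p" unfolding P(2) using \<open>1 \<le> m\<close> P(1) by (intro sum_pos) (auto intro: order.strict_trans[of 0 1])
  then have p: "0 < p" and q: "0 < q" using P(3) by auto
  let ?E = "embedding_const {1..m} P p q" and ?c = "((6 ^ CARD('n)) ^ m) powr q :: real"
  let ?S = "sawyer_const m \<alpha> p q \<sigma> \<omega>"
  let ?n = "\<lambda>i. Lp_norm (P i) (dual_weight (P i) \<sigma>) (\<lambda>x. ennreal \<bar>f i x\<bar>)"
  have E: "0 \<le> ?E"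
    using geom_const_pos[OF p] by (simp add: embedding_const_def)
  have two: "ennreal (2 ^ CARD('n)) = 2 ^ CARD('n)"
    by (metis ennreal_numeral ennreal_power zero_le_numeral)
  have fm: "family_max (grid N S) (cube_term m \<alpha> f) \<in> borel_measurable (weight_measure \<omega>)" for N and S :: "'n set"
    using closure_grid(3) by (intro borel_measurable_family_max countable_grid) auto
  have "(\<integral>\<^sup>+x. ennpowr (frac_maximal m \<alpha> f x) q * ennreal (\<omega> x) \<partial>lebesgue)
      = (\<integral>\<^sup>+x. ennpowr (frac_maximal m \<alpha> f x) q \<partial>weight_measure \<omega>)"
    by (subst nn_integral_density) (auto simp: mult.commute)
  also have "\<dots> \<le> (\<integral>\<^sup>+x. liminf (\<lambda>N. \<Sum>S\<in>(UNIV :: 'n set set).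
      ennreal ?c * ennpowr (family_max (grid N S) (cube_term m \<alpha> f) x) q) \<partial>weight_measure \<omega>)"
    using \<open>1 \<le> m\<close> \<open>0 \<le> \<alpha>\<close> q by (intro nn_integral_mono frac_maximal_le_liminf_grid)
  \<comment> \<open>Fatou's lemma.\<close>
  also have "\<dots> \<le> liminf (\<lambda>N. \<integral>\<^sup>+x. (\<Sum>S\<in>(UNIV :: 'n set set).
      ennreal ?c * ennpowr (family_max (grid N S) (cube_term m \<alpha> f) x) q) \<partial>weight_measure \<omega>)"
    by (intro nn_integral_liminf borel_measurable_sum borel_measurable_times_ennreal
        borel_measurable_const borel_measurable_ennpowr fm)
  \<comment> \<open>All grids obey the same bound, free of N, so the lower limit is that of a
    constant sequence.\<close>
  also have "\<dots> \<le> liminf (\<lambda>N::nat. ennreal (2 ^ CARD('n)) * (ennreal ?c * (ennreal ?E * ennpowr ?S q * (\<Prod>i = 1..m. ennpowr (?n i) q))))"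
  proof (intro Liminf_mono always_eventually allI)
    fix N
    have "(\<integral>\<^sup>+x. (\<Sum>S\<in>(UNIV :: 'n set set).
        ennreal ?c * ennpowr (family_max (grid N S) (cube_term m \<alpha> f) x) q) \<partial>weight_measure \<omega>)
      = (\<Sum>S\<in>(UNIV :: 'n set set). ennreal ?c *
          (\<integral>\<^sup>+x. ennpowr (family_max (grid N S) (cube_term m \<alpha> f) x) q \<partial>weight_measure \<omega>))"
      using fm by (subst nn_integral_sum) (auto intro!: sum.cong nn_integral_cmult)
    also have "\<dots> \<le> (\<Sum>S\<in>(UNIV :: 'n set set). ennreal ?c * (ennreal ?E * ennpowr ?S q * (\<Prod>i = 1..m. ennpowr (?n i) q)))"
      using \<open>1 \<le> m\<close> P \<sigma> \<omega> f by (intro sum_mono mult_left_mono grid_bound) auto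
    finally show "(\<integral>\<^sup>+x. (\<Sum>S\<in>(UNIV :: 'n set set).
        ennreal ?c * ennpowr (family_max (grid N S) (cube_term m \<alpha> f) x) q) \<partial>weight_measure \<omega>)
      \<le> ennreal (2 ^ CARD('n)) * (ennreal ?c * (ennreal ?E * ennpowr ?S q * (\<Prod>i = 1..m. ennpowr (?n i) q)))"
      by (simp add: two)
  qed
  also have "\<dots> = ennreal (2 ^ CARD('n) * (?c * ?E)) * ennpowr (?S * (\<Prod>i = 1..m. ?n i)) q"
    using E by (simp add: Liminf_const ennreal_mult ennpowr_mult ennpowr_prod mult.assoc)
  finally have "Lp_norm q \<omega> (frac_maximal m \<alpha> f)
      \<le> ennpowr (ennreal (2 ^ CARD('n) * (?c * ?E)) * ennpowr (?S * (\<Prod>i = 1..m. ?n i)) q) (1 / q)"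
    unfolding Lp_norm_def using q by (intro ennpowr_mono) auto
  also have "\<dots> = ennreal C * (?S * (\<Prod>i = 1..m. ?n i))"
  proof -
    have "0 \<le> 2 ^ CARD('n) * (?c * ?E)" using E by (intro mult_nonneg_nonneg) auto
    then show ?thesis using q by (simp only: C_def ennpowr_mult[of "ennreal _"] ennpowr_ennreal ennpowr_ennpowr) simp
  qed
  finally show "Lp_norm q \<omega> (frac_maximal m \<alpha> f) \<le> ennreal C * ?S * (\<Prod>i = 1..m. ?n i)"
    by (simp add: mult.assoc)
qed

theorem corollary1p5:
  fixes m :: nat and P :: "nat \<Rightarrow> real" and \<alpha> p q :: real
  assumes "1 \<le> m"
    and "\<And>i. i \<in> {1..m} \<Longrightarrow> 1 < P i"
    and "0 \<le> \<alpha>" and "\<alpha> < real m * real CARD('n)"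
    and "1 / p = (\<Sum>i = 1..m. 1 / P i)"
    and "p \<le> q"
  shows "\<exists>C>0. \<forall>\<sigma> \<omega> :: real ^ 'n \<Rightarrow> real. weight \<sigma> \<longrightarrow> weight \<omega> \<longrightarrow>
           (maximal_bounded m \<alpha> P q \<sigma> \<omega> \<longleftrightarrow> sawyer_const m \<alpha> p q \<sigma> \<omega> < \<infinity>) \<and>
           ennreal (1 / C) * sawyer_const m \<alpha> p q \<sigma> \<omega> \<le> maximal_norm m \<alpha> P q \<sigma> \<omega> \<and>
           maximal_norm m \<alpha> P q \<sigma> \<omega> \<le> ennreal C * sawyer_const m \<alpha> p q \<sigma> \<omega>"
proof -
  define C0 where "C0 = (2 ^ CARD('n) * (((6 ^ CARD('n)) ^ m) powr q * embedding_const {1..m} P p q)) powr (1 / q)"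
  \<comment> \<open>The maximum with 1 makes C positive and serves both inequalities: the lower one
    holds with constant 1, the upper one with \<open>C0\<close>.\<close>
  define C where "C = max 1 C0"
  have "0 < 1 / p" unfolding assms(5) using assms(1,2) by (intro sum_pos) (auto intro: order.strict_trans[of 0 1])
  then have q: "0 < q" using assms(6) by simp
  show ?thesis
  proof (intro exI[of _ C] conjI allI impI)
    fix \<sigma> \<omega> :: "real ^ 'n \<Rightarrow> real" assume \<sigma>: "weight \<sigma>" and \<omega>: "weight \<omega>"
    let ?S = "sawyer_const m \<alpha> p q \<sigma> \<omega>"
    have lower: "?S \<le> K" if "maximal_bound m \<alpha> P q \<sigma> \<omega> K" for K
      by (rule sawyer_const_le[OF assms(1,2,5) q \<sigma> that])
    have upper: "maximal_bound m \<alpha> P q \<sigma> \<omega> (ennreal C0 * ?S)"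
      unfolding C0_def by (rule maximal_bound_sawyer_const[OF assms(1,2,5,6,3) \<sigma> \<omega>])
    show "maximal_bounded m \<alpha> P q \<sigma> \<omega> \<longleftrightarrow> ?S < \<infinity>"
    proof
      assume "maximal_bounded m \<alpha> P q \<sigma> \<omega>"
      then show "?S < \<infinity>" using lower unfolding maximal_bounded_def by (blast intro: le_less_trans)
    next
      assume "?S < \<infinity>"
      then have "ennreal C0 * ?S < \<infinity>" by (simp add: ennreal_mult_less_top)
      then show "maximal_bounded m \<alpha> P q \<sigma> \<omega>"
        unfolding maximal_bounded_def
        using upper borel_measurable_frac_maximal[OF assms(1,3)] by blast
    qed
    have "ennreal (1 / C) * ?S \<le> 1 * ?S"
      by (intro mult_right_mono) (auto simp: C_def ennreal_le_1)
    also have "1 * ?S \<le> maximal_norm m \<alpha> P q \<sigma> \<omega>"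
      unfolding maximal_norm_def using lower by (auto intro: Inf_greatest)
    finally show "ennreal (1 / C) * ?S \<le> maximal_norm m \<alpha> P q \<sigma> \<omega>" .
    have "maximal_norm m \<alpha> P q \<sigma> \<omega> \<le> ennreal C0 * ?S"
      unfolding maximal_norm_def using upper by (auto intro: Inf_lower)
    also have "\<dots> \<le> ennreal C * ?S"
      by (intro mult_right_mono ennreal_leI) (auto simp: C_def)
    finally show "maximal_norm m \<alpha> P q \<sigma> \<omega> \<le> ennreal C * ?S" .
  qed (simp add: C_def)
qed

end
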